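(* (i) For positive integers $L,L'$ not depending on $q$, $T_{\rm rel}(L')\succ T_{\rm rel}(L)$ if and only if $\lceil\log_2L'\rceil>\lceil\log_2L\rceil$. (ii) For every $\gamma\in(0,1)$ there exists $\lambda=\lambda(\gamma)>1$ such that for every $d>0$, with $L=\lfloor d/q^\gamma\rfloor$, one has $T_{\rm rel}(\lfloor\lambda L\rfloor)\succ T_{\rm rel}(L)$. Moreover, if $\gamma<1/2$ one may take $\lambda=2$.
   Context: Fix $q\in(0,1/2)$, $p=1-q$. $T_{\rm rel}(L)$ denotes the relaxation time (inverse spectral gap) of the East process on $\Lambda=\{1,\dots,L\}$: the Markov chain on $\{0,1\}^\Lambda$ with generator $\mathcal L f(\sigma)=\sum_{x\in\Lambda}c_x(\sigma)[\pi_x(f)-f](\sigma)$, $c_1\equiv1$, $c_x(\sigma)=1-\sigma_{x-1}$ for $x\ge2$, where $\pi_x(f)$ averages $f$ over $\sigma_x\sim$ Bernoulli$(p)$ (i.e. $\sigma_x=1$ w.p. $p$); the reversible measure is the product Bernoulli$(p)$ measure $\pi$, and the gap is $\inf_f \sum_x\pi(c_x\mathrm{Var}_x f)/\mathrm{Var}_\pi(f)$. For positive functions $f,h$ of $q\in(0,1)$, $f\succ h$ means that there is $\beta>0$ with $\liminf_{q\downarrow0}q^{\beta}f(q)/h(q)>0$. *)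

theory Defs
  imports "HOL-Analysis.Analysis" "HOL-Library.Liminf_Limsup" "HOL-Library.Extended_Real"
begin

text \<open>A configuration on \<Lambda> = {1..L} is encoded by the set of sites x with sigma_x = 1.
  The density of a site being 1 is p = 1 - q.\<close>

definition east_configs :: "nat \<Rightarrow> nat set set" where
  "east_configs L = Pow {1..L}"

definition east_pi :: "real \<Rightarrow> nat \<Rightarrow> nat set \<Rightarrow> real" where
  "east_pi q L \<sigma> = (1 - q) ^ card \<sigma> * q ^ (L - card \<sigma>)"

definition east_mean :: "real \<Rightarrow> nat \<Rightarrow> (nat set \<Rightarrow> real) \<Rightarrow> real" where
  "east_mean q L f = (\<Sum>\<sigma>\<in>east_configs L. east_pi q L \<sigma> * f \<sigma>)"

definition east_var :: "real \<Rightarrow> nat \<Rightarrow> (nat set \<Rightarrow> real) \<Rightarrow> real" where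
  "east_var q L f = (\<Sum>\<sigma>\<in>east_configs L. east_pi q L \<sigma> * (f \<sigma> - east_mean q L f)\<^sup>2)"

definition east_c :: "nat \<Rightarrow> nat set \<Rightarrow> real" where
  "east_c x \<sigma> = (if x = 1 then 1 else if x - 1 \<in> \<sigma> then 0 else 1)"

definition east_local_var :: "real \<Rightarrow> nat \<Rightarrow> (nat set \<Rightarrow> real) \<Rightarrow> nat set \<Rightarrow> real" where
  "east_local_var q x f \<sigma> =
     (let p = 1 - q; m = p * f (insert x \<sigma>) + q * f (\<sigma> - {x})
      in p * (f (insert x \<sigma>) - m)\<^sup>2 + q * (f (\<sigma> - {x}) - m)\<^sup>2)"

definition east_dirichlet :: "real \<Rightarrow> nat \<Rightarrow> (nat set \<Rightarrow> real) \<Rightarrow> real" where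
  "east_dirichlet q L f =
     (\<Sum>x\<in>{1..L}. \<Sum>\<sigma>\<in>east_configs L. east_pi q L \<sigma> * (east_c x \<sigma> * east_local_var q x f \<sigma>))"

definition east_gap :: "real \<Rightarrow> nat \<Rightarrow> real" where
  "east_gap q L = Inf {east_dirichlet q L f / east_var q L f | f. east_var q L f \<noteq> 0}"

definition T_rel :: "real \<Rightarrow> nat \<Rightarrow> real" where
  "T_rel q L = 1 / east_gap q L"

definition succ_q :: "(real \<Rightarrow> real) \<Rightarrow> (real \<Rightarrow> real) \<Rightarrow> bool" where
  "succ_q f h \<longleftrightarrow> (\<exists>\<beta>>0. Liminf (at_right 0) (\<lambda>q. ereal (q powr \<beta> * f q / h q)) > 0)"

end

(*
  Write lambda(L) for the bottom eigenvalue of the East process on L - 1 sites killed at rate one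
  whenever the last site is 0.  Splitting a function on L sites according to the last site gives
  gap(L) = min of lambda(x) over x <= L.  Let cap(L - 1) be the least killed Dirichlet energy of
  a function with values in [0,1] that equals 1 at the all-ones configuration.

  Cutting a function at its value in the all-ones configuration gives
  1/lambda(L) <= 1/cap(L - 1) + 1/lambda(L - 1): the part above the cut vanishes at all-ones, and
  right of the first zero it sees a shorter killed box.  Hence cap(L - 1)/L <= gap(L), while
  gap(L) <= cap(L - 1)/(1 - q)^(L - 1).

  For test functions g on [1,n], the function (1 - a) 1_{right half all ones} + a g(right half),
  with a = 1 - g(left half) off the zeros at site n and a = 1 on them, shows
  cap(2n) <= 3 q n cap(n): the energy of a is paid only if the right half has a zero, that of g
  only if the left half has one.  So T_rel(2^m L)/T_rel(L) is at least of order
  1/(L (C q L)^m), which for L of order q^(-gamma) diverges like a power of 1/q as soon as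
  m (1 - gamma) > gamma; for gamma < 1/2 this allows m = 1.  For fixed L the same recursion,
  together with lambda(2L) >= q/3 lambda(L), gives T_rel(L) = Theta(q^(-ceil(log2 L))).
*)

theory Submission
  imports Defs "HOL-Real_Asymp.Real_Asymp"
begin

context
  fixes q :: real
  assumes q0: "0 < q" and q1: "q < 1"
begin

section \<open>Means and Dirichlet forms over lists of spins\<close>

text \<open>A configuration is a list of spins, True for 1; the left neighbour of the first
  site is 0 iff the parameter \<open>c\<close> below is true.  The weight \<open>k\<close> is the killing rate at a last
  site 0, so \<open>k = 0\<close> gives the plain Dirichlet form.\<close>

primrec mean :: "nat \<Rightarrow> (bool list \<Rightarrow> real) \<Rightarrow> real" where
  "mean 0 f = f []"
| "mean (Suc n) f = (1 - q) * mean n (\<lambda>s. f (True # s)) + q * mean n (\<lambda>s. f (False # s))"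

primrec facil :: "bool \<Rightarrow> bool list \<Rightarrow> bool" where
  "facil c [] = c"
| "facil c (x # s) = facil (\<not> x) s"

primrec form :: "real \<Rightarrow> bool \<Rightarrow> nat \<Rightarrow> (bool list \<Rightarrow> real) \<Rightarrow> real" where
  "form k c 0 f = (if c then k * (f [])\<^sup>2 else 0)"
| "form k c (Suc n) f =
     (if c then (1 - q) * q * mean n (\<lambda>s. (f (True # s) - f (False # s))\<^sup>2) else 0)
     + (1 - q) * form k False n (\<lambda>s. f (True # s)) + q * form k True n (\<lambda>s. f (False # s))"

section \<open>Expectation under the product Bernoulli measure\<close>

lemma mean_cong: "(\<And>s. length s = n \<Longrightarrow> f s = g s) \<Longrightarrow> mean n f = mean n g"
proof (induction n arbitrary: f g)
  case (Suc n)
  have "mean n (\<lambda>s. f (x # s)) = mean n (\<lambda>s. g (x # s))" for x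
    by (rule Suc.IH) (simp add: Suc.prems)
  then show ?case by simp
qed simp

lemma mean_mono: "(\<And>s. length s = n \<Longrightarrow> f s \<le> g s) \<Longrightarrow> mean n f \<le> mean n g"
proof (induction n arbitrary: f g)
  case (Suc n)
  have "mean n (\<lambda>s. f (x # s)) \<le> mean n (\<lambda>s. g (x # s))" for x
    by (rule Suc.IH) (simp add: Suc.prems)
  then show ?case using q0 q1 by (simp add: add_mono mult_left_mono)
qed simp

lemma mean_const [simp]: "mean n (\<lambda>s. k) = k"
  by (induction n) (simp_all add: algebra_simps)

lemma mean_nonneg: "(\<And>s. length s = n \<Longrightarrow> 0 \<le> f s) \<Longrightarrow> 0 \<le> mean n f"
  using mean_mono[of n "\<lambda>s. 0" f] by simp

lemma mean_add: "mean n (\<lambda>s. f s + g s) = mean n f + mean n g"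
  by (induction n arbitrary: f g) (simp_all add: algebra_simps)

lemma mean_cmult: "mean n (\<lambda>s. k * f s) = k * mean n f"
  by (induction n arbitrary: f) (simp_all add: algebra_simps)

lemma mean_diff: "mean n (\<lambda>s. f s - g s) = mean n f - mean n g"
  using mean_add[of n f "\<lambda>s. - 1 * g s"] mean_cmult[of n "- 1" g] by simp

lemma mean_append: "mean (m + n) f = mean m (\<lambda>a. mean n (\<lambda>b. f (a @ b)))"
  by (induction m arbitrary: f) simp_all

lemma mean_swap: "mean n (\<lambda>b. mean m (\<lambda>a. F a b)) = mean m (\<lambda>a. mean n (\<lambda>b. F a b))"
  by (induction m arbitrary: F) (simp_all add: mean_add mean_cmult)

lemma mean_snoc:
  "mean (Suc n) f = (1 - q) * mean n (\<lambda>s. f (s @ [True])) + q * mean n (\<lambda>s. f (s @ [False]))"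
  using mean_append[of n 1 f] by (simp add: mean_add mean_cmult)

lemma variance_eq: "mean n (\<lambda>s. (f s - mean n f)\<^sup>2) = mean n (\<lambda>s. (f s)\<^sup>2) - (mean n f)\<^sup>2"
proof -
  have "(\<lambda>s. (f s - mean n f)\<^sup>2) = (\<lambda>s. ((f s)\<^sup>2 - 2 * mean n f * f s) + (mean n f)\<^sup>2)"
    by (simp add: power2_eq_square algebra_simps)
  then have "mean n (\<lambda>s. (f s - mean n f)\<^sup>2)
      = mean n (\<lambda>s. (f s)\<^sup>2) - 2 * mean n f * mean n f + (mean n f)\<^sup>2"
    by (simp only: mean_add mean_diff mean_cmult mean_const)
  then show ?thesis by (simp add: power2_eq_square)
qed

lemma mean_square_le: "(mean n f)\<^sup>2 \<le> mean n (\<lambda>s. (f s)\<^sup>2)"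
  using variance_eq[of n f] mean_nonneg[of n "\<lambda>s. (f s - mean n f)\<^sup>2"] by simp

text \<open>Union bound: some spin is 0 with probability at most \<open>q * real n\<close>, and on
  the complement \<open>f\<close> vanishes.\<close>

lemma mean_off_ones:
  assumes "\<And>s. length s = n \<Longrightarrow> f s \<le> 1" "f (replicate n True) = 0"
  shows "mean n f \<le> q * real n"
  using assms
proof (induction n arbitrary: f)
  case (Suc n)
  have "mean n (\<lambda>s. f (True # s)) \<le> q * real n"
    by (rule Suc.IH) (use Suc.prems in auto)
  then have "(1 - q) * mean n (\<lambda>s. f (True # s)) \<le> (1 - q) * (q * real n)"
    by (rule mult_left_mono) (use q1 in simp)
  also have "\<dots> \<le> 1 * (q * real n)"
    by (rule mult_right_mono) (use q0 in auto)
  finally have "(1 - q) * mean n (\<lambda>s. f (True # s)) \<le> 1 * (q * real n)" .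
  moreover have "mean n (\<lambda>s. f (False # s)) \<le> 1"
    using mean_mono[of n "\<lambda>s. f (False # s)" "\<lambda>s. 1"] Suc.prems by simp
  then have "q * mean n (\<lambda>s. f (False # s)) \<le> q * 1"
    by (rule mult_left_mono) (use q0 in simp)
  ultimately show ?case by (simp add: algebra_simps)
qed simp

lemma mean_ge_ones:
  assumes "\<And>s. 0 \<le> f s"
  shows "(1 - q) ^ n * f (replicate n True) \<le> mean n f"
  using assms
proof (induction n arbitrary: f)
  case (Suc n)
  have "(1 - q) * ((1 - q) ^ n * f (True # replicate n True)) \<le> (1 - q) * mean n (\<lambda>s. f (True # s))"
    using Suc.IH[of "\<lambda>s. f (True # s)"] Suc.prems q1 by (intro mult_left_mono) auto
  moreover have "0 \<le> q * mean n (\<lambda>s. f (False # s))"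
    using mean_nonneg[of n "\<lambda>s. f (False # s)"] Suc.prems q0 by simp
  ultimately show ?case by simp
qed simp

section \<open>Algebra of the Dirichlet form\<close>

lemma form_cong: "(\<And>s. length s = n \<Longrightarrow> f s = g s) \<Longrightarrow> form k c n f = form k c n g"
proof (induction n arbitrary: f g c)
  case (Suc n)
  have "form k c n (\<lambda>s. f (x # s)) = form k c n (\<lambda>s. g (x # s))" for x c
    by (rule Suc.IH) (simp add: Suc.prems)
  moreover have "mean n (\<lambda>s. (f (True # s) - f (False # s))\<^sup>2)
      = mean n (\<lambda>s. (g (True # s) - g (False # s))\<^sup>2)"
    by (rule mean_cong) (simp add: Suc.prems)
  ultimately show ?case by simp
qed simp

text \<open>The form is a sum, with nonnegative weights, of squared increments and squared values,
  so pointwise comparisons pass to energies. It serves both for cutting a function at a level and,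
  with \<open>w\<close> zero, for taking absolute values.\<close>

lemma form_superadd:
  assumes "0 \<le> k"
    and "\<And>s t. (u s - u t)\<^sup>2 + (w s - w t)\<^sup>2 \<le> (g s - g t)\<^sup>2"
    and "\<And>s. (u s)\<^sup>2 + (w s)\<^sup>2 \<le> (g s)\<^sup>2"
  shows "form k c n u + form k c n w \<le> form k c n g"
  using assms(2,3)
proof (induction n arbitrary: u w g c)
  case 0
  then show ?case using assms(1) mult_left_mono[of "(u [])\<^sup>2 + (w [])\<^sup>2" "(g [])\<^sup>2" k]
    by (simp add: distrib_left)
next
  case (Suc n)
  have IH: "form k c n (\<lambda>s. u (x # s)) + form k c n (\<lambda>s. w (x # s)) \<le> form k c n (\<lambda>s. g (x # s))"
    for x c
    by (rule Suc.IH) (use Suc.prems in auto)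
  have "mean n (\<lambda>s. (u (True # s) - u (False # s))\<^sup>2) + mean n (\<lambda>s. (w (True # s) - w (False # s))\<^sup>2)
      \<le> mean n (\<lambda>s. (g (True # s) - g (False # s))\<^sup>2)"
    unfolding mean_add[symmetric] by (rule mean_mono) (use Suc.prems in auto)
  then have "(1 - q) * q * (mean n (\<lambda>s. (u (True # s) - u (False # s))\<^sup>2)
        + mean n (\<lambda>s. (w (True # s) - w (False # s))\<^sup>2))
      \<le> (1 - q) * q * mean n (\<lambda>s. (g (True # s) - g (False # s))\<^sup>2)"
    by (rule mult_left_mono) (use q0 q1 in simp)
  moreover have "(1 - q) * (form k False n (\<lambda>s. u (True # s)) + form k False n (\<lambda>s. w (True # s)))
      \<le> (1 - q) * form k False n (\<lambda>s. g (True # s))"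
    by (rule mult_left_mono[OF IH]) (use q1 in simp)
  moreover have "q * (form k True n (\<lambda>s. u (False # s)) + form k True n (\<lambda>s. w (False # s)))
      \<le> q * form k True n (\<lambda>s. g (False # s))"
    by (rule mult_left_mono[OF IH]) (use q0 in simp)
  ultimately show ?case by (auto simp: algebra_simps)
qed

lemma form_nonneg: "0 \<le> k \<Longrightarrow> 0 \<le> form k c n f"
proof (induction n arbitrary: f c)
  case (Suc n)
  then show ?case using q0 q1 by (auto intro!: add_nonneg_nonneg mult_nonneg_nonneg mean_nonneg)
qed simp

lemma form_False_le: "0 \<le> k \<Longrightarrow> form k False n f \<le> form k c n f"
  using q0 q1 by (cases n) (auto intro!: mult_nonneg_nonneg mean_nonneg)

lemma form_scale: "form k c n (\<lambda>s. r * f s) = r\<^sup>2 * form k c n f"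
proof (induction n arbitrary: f c)
  case (Suc n)
  have "mean n (\<lambda>s. (r * f (True # s) - r * f (False # s))\<^sup>2)
      = r\<^sup>2 * mean n (\<lambda>s. (f (True # s) - f (False # s))\<^sup>2)"
    unfolding mean_cmult[symmetric] by (rule mean_cong) (simp add: power2_eq_square algebra_simps)
  then show ?case by (simp add: Suc.IH algebra_simps)
qed (simp add: power_mult_distrib)

lemma form_shift: "form 0 c n (\<lambda>s. r + f s) = form 0 c n f"
  by (induction n arbitrary: f c) auto

text \<open>With p = 1 - q, the identity p Q(f) + q Q(g) = Q(p f + q g) + p q Q(f - g) holds for
  every quadratic form Q. In \<open>poincare\<close> it splits the energy according to the last
  spin.\<close>

lemma form_average:
  "form k c n (\<lambda>s. (1 - q) * f s + q * g s) + (1 - q) * q * form k c n (\<lambda>s. f s - g s)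
   = (1 - q) * form k c n f + q * form k c n g"
proof (induction n arbitrary: f g c)
  case 0
  then show ?case by (cases c) (simp_all add: power2_eq_square algebra_simps)
next
  case (Suc n)
  let ?D = "\<lambda>h. mean n (\<lambda>s. (h (True # s) - h (False # s))\<^sup>2)"
  have "?D (\<lambda>s. (1 - q) * f s + q * g s) + (1 - q) * q * ?D (\<lambda>s. f s - g s)
      = (1 - q) * ?D f + q * ?D g"
    unfolding mean_cmult[symmetric] mean_add[symmetric]
    by (rule mean_cong) (simp add: power2_eq_square algebra_simps)
  then have D: "?D (\<lambda>s. (1 - q) * f s + q * g s)
      = (1 - q) * ?D f + q * ?D g - (1 - q) * q * ?D (\<lambda>s. f s - g s)" by linarith
  have E: "form k c n (\<lambda>s. (1 - q) * f (x # s) + q * g (x # s))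
      = (1 - q) * form k c n (\<lambda>s. f (x # s)) + q * form k c n (\<lambda>s. g (x # s))
        - (1 - q) * q * form k c n (\<lambda>s. f (x # s) - g (x # s))" for x c
    using Suc.IH[of c "\<lambda>s. f (x # s)" "\<lambda>s. g (x # s)"] by linarith
  \<comment> \<open>The terms in \<open>d\<close>, \<open>d1\<close>, \<open>d2\<close> cancel for
    every weight \<open>r\<close>, so it need not be expanded.\<close>
  have alg: "(if c then r * ((1 - q) * a + q * b - r * d) else 0)
        + (1 - q) * ((1 - q) * a1 + q * b1 - r * d1) + q * ((1 - q) * a2 + q * b2 - r * d2)
        + r * ((if c then r * d else 0) + (1 - q) * d1 + q * d2)
      = (1 - q) * ((if c then r * a else 0) + (1 - q) * a1 + q * a2)
        + q * ((if c then r * b else 0) + (1 - q) * b1 + q * b2)"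
    for r a b d a1 b1 d1 a2 b2 d2 :: real
    by (cases c) (simp_all add: algebra_simps)
  show ?case unfolding form.simps D E by (rule alg[where r = "(1 - q) * q"])
qed

text \<open>Constraints look only to the left. Hence the sites of the left block see that block
  alone, and the left block enters the energy of the right one only through its last spin. Killing
  happens at the end of the whole box, so it sits in the second term.\<close>

lemma form_append:
  "form k c (m + n) f = mean n (\<lambda>b. form 0 c m (\<lambda>a. f (a @ b)))
     + mean m (\<lambda>a. form k (facil c a) n (\<lambda>b. f (a @ b)))"
proof (induction m arbitrary: c f)
  case 0
  then show ?case by (cases c) simp_all
next
  case (Suc m)
  have "mean (m + n) (\<lambda>s. (f (True # s) - f (False # s))\<^sup>2)
      = mean n (\<lambda>b. mean m (\<lambda>a. (f (True # a @ b) - f (False # a @ b))\<^sup>2))"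
    by (simp add: mean_append mean_swap[of n m])
  then show ?case
    by (simp add: Suc.IH mean_add mean_cmult distrib_left)
qed

text \<open>The case of an empty right block in \<open>form_append\<close>: what remains of its form
  is the killing.\<close>

lemma form_kill_eq:
  "form k c n f = form 0 c n f + k * mean n (\<lambda>a. if facil c a then (f a)\<^sup>2 else 0)"
proof -
  have "mean n (\<lambda>a. form k (facil c a) 0 (\<lambda>b. f (a @ b)))
      = mean n (\<lambda>a. k * (if facil c a then (f a)\<^sup>2 else 0))"
    by (rule mean_cong) simp
  then show ?thesis using form_append[of k c n 0 f] by (simp add: mean_cmult)
qed

lemma form_snoc:
  "form 0 c (Suc n) f = (1 - q) * form 0 c n (\<lambda>a. f (a @ [True])) + q * form 0 c n (\<lambda>a. f (a @ [False]))
     + (1 - q) * q * mean n (\<lambda>a. if facil c a then (f (a @ [True]) - f (a @ [False]))\<^sup>2 else 0)"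
proof -
  have "mean n (\<lambda>a. form 0 (facil c a) 1 (\<lambda>b. f (a @ b)))
      = mean n (\<lambda>a. (1 - q) * q * (if facil c a then (f (a @ [True]) - f (a @ [False]))\<^sup>2 else 0))"
    by (rule mean_cong) simp
  then show ?thesis using form_append[of 0 c n 1 f] by (simp add: mean_cmult mean_add)
qed

text \<open>Let \<open>h\<close> be the average of \<open>f\<close> over the last spin and
  \<open>g\<close> the difference of its two values. Passing from \<open>f\<close> to
  \<open>h\<close> lowers the variance by (1 - q) q E[g^2] and the energy by (1 - q) q times the
  killed energy of \<open>g\<close>. Peeling off one site at a time meets every length below
  \<open>L\<close>, which is why the hypothesis covers them all.\<close>

lemma poincare:
  assumes "0 \<le> r" and "\<And>m g. m < L \<Longrightarrow> r * mean m (\<lambda>s. (g s)\<^sup>2) \<le> form 1 True m g"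
  shows "r * (mean L (\<lambda>s. (f s)\<^sup>2) - (mean L f)\<^sup>2) \<le> form 0 True L f"
  using assms(2)
proof (induction L arbitrary: f)
  case (Suc L)
  define h where "h = (\<lambda>a. (1 - q) * f (a @ [True]) + q * f (a @ [False]))"
  define g where "g = (\<lambda>a. f (a @ [True]) - f (a @ [False]))"
  have mh: "mean (Suc L) f = mean L h"
    unfolding mean_snoc h_def by (simp add: mean_add mean_cmult)
  have sq: "mean (Suc L) (\<lambda>s. (f s)\<^sup>2)
      = mean L (\<lambda>s. (h s)\<^sup>2) + (1 - q) * q * mean L (\<lambda>s. (g s)\<^sup>2)"
    unfolding mean_snoc h_def g_def mean_cmult[symmetric] mean_add[symmetric]
    by (rule mean_cong) (simp add: power2_eq_square algebra_simps)
  have "form 0 True L h + (1 - q) * q * form 0 True L g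
      = (1 - q) * form 0 True L (\<lambda>a. f (a @ [True])) + q * form 0 True L (\<lambda>a. f (a @ [False]))"
    unfolding h_def g_def by (rule form_average)
  \<comment> \<open>Flips of the last site, where it is facilitated, turn into the killing of
    \<open>g\<close> at rate one.\<close>
  then have fm: "form 0 True (Suc L) f = form 0 True L h + (1 - q) * q * form 1 True L g"
    unfolding form_snoc form_kill_eq[of 1 True L g] g_def[symmetric]
    by (simp add: g_def distrib_left cong: if_cong)
  have "(1 - q) * q * (r * mean L (\<lambda>s. (g s)\<^sup>2)) \<le> (1 - q) * q * form 1 True L g"
    by (rule mult_left_mono[OF Suc.prems]) (use q0 q1 in auto)
  moreover have "r * (mean L (\<lambda>s. (h s)\<^sup>2) - (mean L h)\<^sup>2) \<le> form 0 True L h"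
    by (rule Suc.IH) (use Suc.prems in auto)
  ultimately show ?case unfolding mh sq fm by (simp add: algebra_simps)
qed simp

text \<open>Condition on the first 0. The sites to its right form a shorter box with a facilitated
  first site, where the hypothesis applies; the only configuration without a 0 contributes nothing.
  Flips of the sites up to that 0 are discarded, so \<open>c\<close> is arbitrary.\<close>

lemma form_vanish_ones:
  assumes "0 \<le> r" and "\<And>m g. m < N \<Longrightarrow> r * mean m (\<lambda>s. (g s)\<^sup>2) \<le> form 1 True m g"
    and "w (replicate N True) = 0"
  shows "r * mean N (\<lambda>s. (w s)\<^sup>2) \<le> form 1 c N w"
  using assms(2,3)
proof (induction N arbitrary: w c)
  case 0
  then show ?case by simp
next
  case (Suc N)
  have "r * mean N (\<lambda>s. (w (True # s))\<^sup>2) \<le> form 1 False N (\<lambda>s. w (True # s))"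
    by (rule Suc.IH) (use Suc.prems in auto)
  then have 1: "(1 - q) * (r * mean N (\<lambda>s. (w (True # s))\<^sup>2)) \<le> (1 - q) * form 1 False N (\<lambda>s. w (True # s))"
    by (rule mult_left_mono) (use q1 in simp)
  have 2: "q * (r * mean N (\<lambda>s. (w (False # s))\<^sup>2)) \<le> q * form 1 True N (\<lambda>s. w (False # s))"
    by (rule mult_left_mono[OF Suc.prems(1)]) (use q0 in auto)
  have 3: "0 \<le> (if c then (1 - q) * q * mean N (\<lambda>s. (w (True # s) - w (False # s))\<^sup>2) else 0)"
    using q0 q1 by (auto intro!: mult_nonneg_nonneg mean_nonneg)
  show ?case using 1 2 3 by (simp add: distrib_left mult.left_commute)
qed

section \<open>The capacity of the all-ones configuration\<close>

text \<open>Both truncations are nondecreasing, so their increments have the same sign, and they add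
  up to \<open>a - b\<close>.\<close>

lemma trunc_square:
  fixes a b :: real
  shows "(min a 1 - min b 1)\<^sup>2 + (max (a - 1) 0 - max (b - 1) 0)\<^sup>2 \<le> (a - b)\<^sup>2"
proof -
  define A where "A = min a 1 - min b 1"
  define B where "B = max (a - 1) 0 - max (b - 1) 0"
  have "a - b = A + B" unfolding A_def B_def by (auto simp: min_def max_def)
  moreover have "0 \<le> A * B"
  proof (cases "a \<le> b")
    case True
    then show ?thesis unfolding A_def B_def by (intro mult_nonpos_nonpos) auto
  next
    case False
    then show ?thesis unfolding A_def B_def by (intro mult_nonneg_nonneg) auto
  qed
  ultimately show ?thesis unfolding A_def[symmetric] B_def[symmetric]
    by (simp add: power2_sum)
qed

text \<open>Competitors for the capacity. The bounds are imposed on lists of every length to avoid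
  side conditions; the forms only see length \<open>n\<close>.\<close>

definition adm :: "nat \<Rightarrow> (bool list \<Rightarrow> real) set" where
  "adm n = {g. (\<forall>s. 0 \<le> g s \<and> g s \<le> 1) \<and> g (replicate n True) = 1}"

lemma admD: "g \<in> adm n \<Longrightarrow> 0 \<le> g s" "g \<in> adm n \<Longrightarrow> g s \<le> 1" "g \<in> adm n \<Longrightarrow> g (replicate n True) = 1"
  unfolding adm_def by auto

text \<open>Normalize the absolute value of \<open>f\<close> to be 1 at all-ones and cut it at
  height 1. The lower part \<open>u\<close> is admissible, with energy at least \<open>C\<close> and
  mean square at most 1; the excess \<open>w\<close> vanishes at all-ones and falls under
  \<open>form_vanish_ones\<close>.\<close>

lemma mean_square_le_capacity:
  assumes r: "0 < r" "\<And>m g. m < N \<Longrightarrow> r * mean m (\<lambda>s. (g s)\<^sup>2) \<le> form 1 True m g"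
    and C: "0 < C" "\<And>g. g \<in> adm N \<Longrightarrow> C \<le> form 1 True N g"
  shows "mean N (\<lambda>s. (f s)\<^sup>2) \<le> (1 / C + 1 / r) * form 1 True N f"
proof -
  define t where "t = \<bar>f (replicate N True)\<bar>"
  show ?thesis
  proof (cases "t = 0")
    case True
    have "r * mean N (\<lambda>s. (f s)\<^sup>2) \<le> form 1 True N f"
      by (rule form_vanish_ones) (use r True t_def in auto)
    then have "mean N (\<lambda>s. (f s)\<^sup>2) \<le> 1 / r * form 1 True N f"
      using r by (simp add: field_simps)
    also have "\<dots> \<le> (1 / C + 1 / r) * form 1 True N f"
      by (rule mult_right_mono) (use C form_nonneg in auto)
    finally show ?thesis .
  next
    case False
    then have t: "0 < t" unfolding t_def by simp
    define g where "g = (\<lambda>s. \<bar>f s\<bar> / t)"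
    define u where "u = (\<lambda>s. min (g s) 1)"
    define w where "w = (\<lambda>s. max (g s - 1) 0)"
    have g0: "0 \<le> g s" for s unfolding g_def using t by simp
    have gf: "form 1 True N g \<le> (1 / t)\<^sup>2 * form 1 True N f"
    proof -
      \<comment> \<open>With second part 0, superadditivity says that absolute values do not raise
        the energy.\<close>
      have "form 1 True N g + form 1 True N (\<lambda>s. 0) \<le> form 1 True N (\<lambda>s. 1 / t * f s)"
      proof (rule form_superadd)
        fix x y
        have "\<bar>\<bar>f x\<bar> - \<bar>f y\<bar>\<bar> \<le> \<bar>f x - f y\<bar>" by linarith
        then have "(\<bar>f x\<bar> - \<bar>f y\<bar>)\<^sup>2 \<le> (f x - f y)\<^sup>2" by (simp add: abs_le_square_iff)
        then have "((\<bar>f x\<bar> - \<bar>f y\<bar>) / t)\<^sup>2 \<le> ((f x - f y) / t)\<^sup>2"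
          by (simp add: power_divide divide_right_mono)
        then show "(g x - g y)\<^sup>2 + (0 - 0)\<^sup>2 \<le> (1 / t * f x - 1 / t * f y)\<^sup>2"
          unfolding g_def by (simp add: diff_divide_distrib)
      qed (auto simp: g_def power_divide)
      moreover have "0 \<le> form 1 True N (\<lambda>s. 0)" by (rule form_nonneg) simp
      ultimately show ?thesis using form_scale[of 1 True N "1 / t" f] by simp
    qed
    have E: "form 1 True N u + form 1 True N w \<le> form 1 True N g"
    proof (rule form_superadd)
      show "(u s)\<^sup>2 + (w s)\<^sup>2 \<le> (g s)\<^sup>2" for s
        using trunc_square[of "g s" 0] g0[of s] unfolding u_def w_def by simp
    qed (use trunc_square in \<open>auto simp: u_def w_def\<close>)
    have gone: "g (replicate N True) = 1" unfolding g_def t_def[symmetric] using t by simp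
    have E1: "C \<le> form 1 True N u"
      by (rule C) (use gone g0 in \<open>auto simp: adm_def u_def\<close>)
    have E2: "r * mean N (\<lambda>s. (w s)\<^sup>2) \<le> form 1 True N w"
      by (rule form_vanish_ones) (use r gone in \<open>auto simp: w_def\<close>)
    \<comment> \<open>Cauchy-Schwarz with weights matching the energy bounds \<open>E1\<close> and
      \<open>E2\<close>.\<close>
    have cs: "(a + b)\<^sup>2 \<le> (1 / C + 1 / r) * (C * a\<^sup>2 + r * b\<^sup>2)" for a b
    proof -
      have "(1 / C + 1 / r) * (C * a\<^sup>2 + r * b\<^sup>2) - (a + b)\<^sup>2 = (r * b - C * a)\<^sup>2 / (r * C)"
        using r C by (simp add: field_simps power2_eq_square)
      moreover have "0 \<le> (r * b - C * a)\<^sup>2 / (r * C)" using r C by simp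
      ultimately show ?thesis by linarith
    qed
    have u1: "mean N (\<lambda>s. (u s)\<^sup>2) \<le> 1"
      using mean_mono[of N "\<lambda>s. (u s)\<^sup>2" "\<lambda>s. 1"] g0 by (simp add: u_def power_le_one)
    have "(1 / t)\<^sup>2 * mean N (\<lambda>s. (f s)\<^sup>2) = mean N (\<lambda>s. (u s + w s)\<^sup>2)"
      unfolding mean_cmult[symmetric]
      by (rule mean_cong) (auto simp: u_def w_def g_def min_def max_def power_divide)
    also have "\<dots> \<le> mean N (\<lambda>s. (1 / C + 1 / r) * (C * (u s)\<^sup>2 + r * (w s)\<^sup>2))"
      by (rule mean_mono) (rule cs)
    also have "\<dots> = (1 / C + 1 / r) * (C * mean N (\<lambda>s. (u s)\<^sup>2) + r * mean N (\<lambda>s. (w s)\<^sup>2))"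
      by (simp only: mean_cmult mean_add)
    also have "\<dots> \<le> (1 / C + 1 / r) * ((1 / t)\<^sup>2 * form 1 True N f)"
    proof (rule mult_left_mono)
      have "C * mean N (\<lambda>s. (u s)\<^sup>2) \<le> C" using u1 C by simp
      then show "C * mean N (\<lambda>s. (u s)\<^sup>2) + r * mean N (\<lambda>s. (w s)\<^sup>2) \<le> (1 / t)\<^sup>2 * form 1 True N f"
        using E E1 E2 gf by linarith
    qed (use r C in auto)
    finally have "(1 / t)\<^sup>2 * mean N (\<lambda>s. (f s)\<^sup>2)
        \<le> (1 / t)\<^sup>2 * ((1 / C + 1 / r) * form 1 True N f)" by (simp only: mult.left_commute)
    then show ?thesis using t by (simp add: mult_le_cancel_left)
  qed
qed

text \<open>Iterates \<open>mean_square_le_capacity\<close>: each added site raises the inverse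
  constant by at most \<open>1 / C\<close>, and the empty box starts at \<open>1 / C\<close> because
  \<open>C\<close> is at most 1 there.\<close>

lemma capacity_poincare:
  assumes C: "0 < C" "\<And>m g. m \<le> N \<Longrightarrow> g \<in> adm m \<Longrightarrow> C \<le> form 1 True m g"
    and "n \<le> N"
  shows "C / (real n + 1) * mean n (\<lambda>s. (f s)\<^sup>2) \<le> form 1 True n f"
  using assms(3)
proof (induction n arbitrary: f rule: less_induct)
  case (less n)
  show ?case
  proof (cases n)
    case 0
    have "C \<le> form 1 True 0 (\<lambda>_. 1)" by (rule C) (auto simp: adm_def)
    then have "C * (f [])\<^sup>2 \<le> 1 * (f [])\<^sup>2" by (intro mult_right_mono) simp_all
    then show ?thesis using 0 by simp
  next
    case (Suc k)
    \<comment> \<open>All lengths \<open>m < n\<close> share the constant \<open>C / real n\<close>,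
      because \<open>m + 1 \<le> n\<close>.\<close>
    have "mean n (\<lambda>s. (f s)\<^sup>2) \<le> (1 / C + 1 / (C / real n)) * form 1 True n f"
    proof (rule mean_square_le_capacity)
      fix m g assume m: "m < n"
      have "C / real n * mean m (\<lambda>s. (g s)\<^sup>2) \<le> C / (real m + 1) * mean m (\<lambda>s. (g s)\<^sup>2)"
        using m C by (intro mult_right_mono mean_nonneg divide_left_mono) auto
      also have "\<dots> \<le> form 1 True m g" by (rule less.IH) (use m less.prems in auto)
      finally show "C / real n * mean m (\<lambda>s. (g s)\<^sup>2) \<le> form 1 True m g" .
    next
      show "C \<le> form 1 True n g" if "g \<in> adm n" for g
        by (rule C(2)[OF less.prems that])
    qed (use C(1) Suc in auto)
    also have "1 / C + 1 / (C / real n) = (real n + 1) / C"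
      by (simp add: add_divide_distrib)
    finally show ?thesis using C by (simp add: field_simps)
  qed
qed

section \<open>Lower bounds on the killed energy by doubling the box\<close>

lemma facil_snoc [simp]: "facil c (s @ [x]) = (\<not> x)"
  by (induction s arbitrary: c) simp_all

lemma facil_nonempty: "s \<noteq> [] \<Longrightarrow> facil c s = facil d s"
  by (cases s) simp_all

lemma facil_replicate: "facil c (replicate n True) = (if n = 0 then c else False)"
  by (induction n arbitrary: c) simp_all

text \<open>The last spin is 0 with probability \<open>q\<close>, and there (E v)^2 <= 2 v^2 + 2 (v
  - E v)^2. So q (E v)^2 is at most twice the killing plus twice the variance; adding q times the
  variance produces the 3.\<close>

lemma mean_facil_square:
  assumes "0 < L"
  shows "q / 3 * mean L (\<lambda>a. (v a)\<^sup>2) \<le> (mean L (\<lambda>a. (v a)\<^sup>2) - (mean L v)\<^sup>2)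
     + mean L (\<lambda>a. if facil True a then (v a)\<^sup>2 else 0)"
proof -
  let ?V = "mean L (\<lambda>a. (v a - mean L v)\<^sup>2)" and ?S = "mean L (\<lambda>a. if facil True a then (v a)\<^sup>2 else 0)"
  obtain k where k: "L = Suc k" using assms by (cases L) auto
  have "q * (mean L v)\<^sup>2 = mean L (\<lambda>a. if facil True a then (mean L v)\<^sup>2 else 0)"
    unfolding k mean_snoc[of k "\<lambda>a. if facil True a then _ else _"] by simp
  also have "\<dots> \<le> mean L (\<lambda>a. 2 * (if facil True a then (v a)\<^sup>2 else 0) + 2 * (v a - mean L v)\<^sup>2)"
  proof (rule mean_mono)
    fix a
    have "(mean L v)\<^sup>2 \<le> 2 * (v a)\<^sup>2 + 2 * (v a - mean L v)\<^sup>2"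
      using zero_le_power2[of "2 * v a - mean L v"] by (simp add: power2_eq_square algebra_simps)
    then show "(if facil True a then (mean L v)\<^sup>2 else 0)
        \<le> 2 * (if facil True a then (v a)\<^sup>2 else 0) + 2 * (v a - mean L v)\<^sup>2" by simp
  qed
  also have "\<dots> = 2 * ?S + 2 * ?V" by (simp only: mean_add mean_cmult)
  finally have 1: "q * (mean L v)\<^sup>2 \<le> 2 * ?S + 2 * ?V" .
  have V0: "0 \<le> ?V" and S0: "0 \<le> ?S" by (auto intro!: mean_nonneg)
  have "q * ?V \<le> 1 * ?V" by (rule mult_right_mono[OF _ V0]) (use q1 in simp)
  with 1 S0 have "q * (?V + (mean L v)\<^sup>2) \<le> 3 * (?V + ?S)" by (simp add: distrib_left)
  then show ?thesis unfolding variance_eq by simp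
qed

text \<open>Cut the box after \<open>L\<close> sites. The left block has Poincare constant
  \<open>r\<close>; when it ends in 0, the right block, shorter than \<open>L\<close>, has killed
  energy at least \<open>r\<close> times its mean square. \<open>mean_facil_square\<close>
  recombines the two at the price \<open>q / 3\<close>.\<close>

lemma form_double:
  assumes r: "0 \<le> r" "\<And>m g. m < L \<Longrightarrow> r * mean m (\<lambda>s. (g s)\<^sup>2) \<le> form 1 True m g"
    and "0 < L" "N < 2 * L"
  shows "q / 3 * r * mean N (\<lambda>s. (f s)\<^sup>2) \<le> form 1 True N f"
proof (cases "N < L")
  case True
  have "q / 3 * r * mean N (\<lambda>s. (f s)\<^sup>2) \<le> r * mean N (\<lambda>s. (f s)\<^sup>2)"
    using q0 q1 r(1) mult_right_mono[of "q / 3" 1 r] by (intro mult_right_mono mean_nonneg) auto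
  then show ?thesis using r(2)[OF True, of f] by linarith
next
  case False
  define n where "n = N - L"
  have N: "N = L + n" and nL: "n < L" using False assms(4) unfolding n_def by auto
  let ?v = "\<lambda>b. (mean L (\<lambda>a. (f (a @ b))\<^sup>2) - (mean L (\<lambda>a. f (a @ b)))\<^sup>2)"
  let ?s = "\<lambda>b. mean L (\<lambda>a. if facil True a then (f (a @ b))\<^sup>2 else 0)"
  have "q / 3 * r * mean N (\<lambda>s. (f s)\<^sup>2) = mean n (\<lambda>b. r * (q / 3 * mean L (\<lambda>a. (f (a @ b))\<^sup>2)))"
    unfolding N mean_append mean_cmult by (simp add: mean_swap[of n L])
  also have "\<dots> \<le> mean n (\<lambda>b. r * (?v b + ?s b))"
    using r(1) mean_facil_square[OF assms(3)] by (intro mean_mono mult_left_mono) auto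
  also have "\<dots> = mean n (\<lambda>b. r * ?v b) + mean n (\<lambda>b. r * ?s b)"
    by (simp only: distrib_left mean_add)
  also have "\<dots> \<le> mean n (\<lambda>b. form 0 True L (\<lambda>a. f (a @ b)))
      + mean L (\<lambda>a. form 1 (facil True a) n (\<lambda>b. f (a @ b)))"
  proof (rule add_mono)
    show "mean n (\<lambda>b. r * ?v b) \<le> mean n (\<lambda>b. form 0 True L (\<lambda>a. f (a @ b)))"
      by (rule mean_mono) (rule poincare[OF r])
    have "mean n (\<lambda>b. r * ?s b) = mean L (\<lambda>a. mean n (\<lambda>b. if facil True a then r * (f (a @ b))\<^sup>2 else 0))"
      unfolding mean_swap[of n L, symmetric] mean_cmult[symmetric] by (intro mean_cong) simp
    also have "\<dots> \<le> mean L (\<lambda>a. form 1 (facil True a) n (\<lambda>b. f (a @ b)))"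
    proof (rule mean_mono)
      fix a
      show "mean n (\<lambda>b. if facil True a then r * (f (a @ b))\<^sup>2 else 0) \<le> form 1 (facil True a) n (\<lambda>b. f (a @ b))"
        using r(2)[OF nL, of "\<lambda>b. f (a @ b)"] by (cases "facil True a") (simp_all add: mean_cmult form_nonneg)
    qed
    finally show "mean n (\<lambda>b. r * ?s b) \<le> mean L (\<lambda>a. form 1 (facil True a) n (\<lambda>b. f (a @ b)))" .
  qed
  also have "\<dots> = form 1 True N f" unfolding N form_append[of 1 True L n] ..
  finally show ?thesis .
qed

text \<open>The doubling starts at the empty box, where the killed energy is exactly the square. A
  killed box of \<open>N\<close> sites governs the process on \<open>N + 1\<close> sites, so
  \<open>N < 2 ^ n\<close> means at most 2^n sites there.\<close>

lemma form_dyadic: "N < 2 ^ n \<Longrightarrow> (q / 3) ^ n * mean N (\<lambda>s. (f s)\<^sup>2) \<le> form 1 True N f"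
proof (induction n arbitrary: N f)
  case (Suc n)
  have "q / 3 * (q / 3) ^ n * mean N (\<lambda>s. (f s)\<^sup>2) \<le> form 1 True N f"
    by (rule form_double[where L = "2 ^ n"]) (use Suc q0 in auto)
  then show ?case by simp
qed simp

text \<open>Behind a left neighbour 1 the all-ones configuration is frozen: no allowed flip enters
  or leaves it and it is not killed, so its value never enters the form.\<close>

lemma form_off_ones:
  "(\<And>s. s \<noteq> replicate n True \<Longrightarrow> u s = v s) \<Longrightarrow> form k False n u = form k False n v"
proof (induction n arbitrary: u v)
  case (Suc n)
  have "form k False n (\<lambda>s. u (True # s)) = form k False n (\<lambda>s. v (True # s))"
    by (rule Suc.IH) (simp add: Suc.prems)
  moreover have "form k True n (\<lambda>s. u (False # s)) = form k True n (\<lambda>s. v (False # s))"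
    by (rule form_cong) (simp add: Suc.prems)
  ultimately show ?case by simp
qed simp

text \<open>Only flips of the last site feel the cut. Their increment becomes the value at last spin
  1, whose square is at most twice the old squared increment plus twice the squared value at last
  spin 0; the killing pays for the latter.\<close>

lemma form_vanish_on_zero_le: "form 0 c n (\<lambda>a. if facil c a then 0 else g a) \<le> 2 * form 1 c n g"
proof (induction n arbitrary: c g)
  case 0
  then show ?case by simp
next
  case (Suc n)
  show ?case
  proof (cases n)
    case 0
    have "(g [True])\<^sup>2 \<le> 2 * (g [True] - g [False])\<^sup>2 + 2 * (g [False])\<^sup>2"
      using zero_le_power2[of "g [True] - 2 * g [False]"] by (simp add: power2_eq_square algebra_simps)
    then have "(1 - q) * q * (g [True])\<^sup>2 \<le> (1 - q) * q * (2 * (g [True] - g [False])\<^sup>2 + 2 * (g [False])\<^sup>2)"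
      by (rule mult_left_mono) (use q0 q1 in simp)
    \<comment> \<open>The flip carries weight \<open>(1 - q) * q\<close>, the killing the larger
      weight \<open>q\<close>.\<close>
    also have "\<dots> \<le> 2 * ((1 - q) * q * (g [True] - g [False])\<^sup>2) + 2 * (q * (g [False])\<^sup>2)"
      using q0 q1 mult_right_mono[of "(1 - q) * q" q "2 * (g [False])\<^sup>2"] by (simp add: distrib_left mult_le_one)
    finally show ?thesis using 0 q0 by simp
  next
    case (Suc m)
    let ?h = "\<lambda>a. if facil c a then 0 else g a"
    \<comment> \<open>In a nonempty tail the last spin alone decides \<open>facil\<close>, so the
      removed spin and the starting flag are immaterial and the induction hypothesis fits either
      flag.\<close>
    have eq: "form 0 d n (\<lambda>s. ?h (x # s)) = form 0 d n (\<lambda>s. if facil d s then 0 else g (x # s))" for d x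
    proof (rule form_cong)
      fix s :: "bool list" assume "length s = n"
      then have "s \<noteq> []" using Suc by auto
      then show "?h (x # s) = (if facil d s then 0 else g (x # s))"
        using facil_nonempty[of s "\<not> x" d] by simp
    qed
    have IH: "form 0 d n (\<lambda>s. ?h (x # s)) \<le> 2 * form 1 d n (\<lambda>s. g (x # s))" for d x
      unfolding eq by (rule Suc.IH)
    have comb: "(if c then r * x else 0) + p * y + q * z \<le> 2 * ((if c then r * x' else 0) + p * y' + q * z')"
      if "r * x \<le> r * (2 * x')" "p * y \<le> p * (2 * y')" "q * z \<le> q * (2 * z')"
      for r x x' p y y' z z' :: real
    proof -
      have "r * x \<le> 2 * (r * x')" "p * y \<le> 2 * (p * y')" "q * z \<le> 2 * (q * z')"
        using that by (simp_all only: mult.left_commute[of _ 2])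
      then show ?thesis by (cases c) simp_all
    qed
    have "mean n (\<lambda>s. (?h (True # s) - ?h (False # s))\<^sup>2) \<le> mean n (\<lambda>s. 2 * (g (True # s) - g (False # s))\<^sup>2)"
    proof (rule mean_mono)
      fix s :: "bool list" assume "length s = n"
      then have "s \<noteq> []" using Suc by auto
      then show "(?h (True # s) - ?h (False # s))\<^sup>2 \<le> 2 * (g (True # s) - g (False # s))\<^sup>2"
        using facil_nonempty[of s True False] by simp
    qed
    then have "(1 - q) * q * mean n (\<lambda>s. (?h (True # s) - ?h (False # s))\<^sup>2)
        \<le> (1 - q) * q * (2 * mean n (\<lambda>s. (g (True # s) - g (False # s))\<^sup>2))"
      unfolding mean_cmult by (rule mult_left_mono) (use q0 q1 in simp)
    moreover have "(1 - q) * form 0 False n (\<lambda>s. ?h (True # s)) \<le> (1 - q) * (2 * form 1 False n (\<lambda>s. g (True # s)))"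
      by (rule mult_left_mono[OF IH]) (use q1 in simp)
    moreover have "q * form 0 True n (\<lambda>s. ?h (False # s)) \<le> q * (2 * form 1 True n (\<lambda>s. g (False # s)))"
      by (rule mult_left_mono[OF IH]) (use q0 in simp)
    ultimately show ?thesis unfolding form.simps(2) by (rule comb)
  qed
qed

text \<open>\<open>al\<close> interpolates between the indicator \<open>e\<close> and
  \<open>h\<close>. If the left block ends in 0, \<open>al\<close> is 1 and the right block carries
  \<open>h\<close>; otherwise the right block is not facilitated from outside and the jump of
  \<open>e\<close> is free. The factors q n and q m bound the probability that a block contains a 0;
  the 2 comes from cutting \<open>g\<close> on last zeros.\<close>

lemma form_concat:
  assumes g: "g \<in> adm m" "h \<in> adm n" and "0 < m"
  shows "\<exists>f \<in> adm (m + n). form 1 True (m + n) f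
    \<le> 2 * q * real n * form 1 True m g + q * real m * form 1 True n h"
proof -
  define al where "al = (\<lambda>a. 1 - (if facil True a then 0 else g a))"
  define e where "e = (\<lambda>b. if b = replicate n True then 1 else 0 :: real)"
  define f where "f = (\<lambda>s. (1 - al (take m s)) * e (drop m s) + al (take m s) * h (drop m s))"
  have al: "0 \<le> al a" "al a \<le> 1" for a unfolding al_def using admD(1,2)[OF g(1)] by auto
  have al1: "al (replicate m True) = 0" unfolding al_def using admD(3)[OF g(1)] \<open>0 < m\<close> by (simp add: facil_replicate)
  have e: "0 \<le> e b" "e b \<le> 1" for b unfolding e_def by auto
  have "f \<in> adm (m + n)"
    unfolding adm_def
  proof (intro CollectI conjI allI)
    fix s
    show "0 \<le> f s" unfolding f_def using al e admD[OF g(2)] by (intro add_nonneg_nonneg mult_nonneg_nonneg) auto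
    have "f s \<le> (1 - al (take m s)) * 1 + al (take m s) * 1"
      unfolding f_def using al e admD[OF g(2)] by (intro add_mono mult_left_mono) auto
    then show "f s \<le> 1" by simp
    show "f (replicate (m + n) True) = 1"
      unfolding f_def using admD(3)[OF g(2)] by (simp add: e_def min_def)
  qed
  moreover have "form 1 True (m + n) f \<le> 2 * q * real n * form 1 True m g + q * real m * form 1 True n h"
  proof -
    have fa: "f (a @ b) = e b + (h b - e b) * al a" if "length a = m" for a b
      unfolding f_def using that by (simp add: algebra_simps)
    \<comment> \<open>\<open>al\<close> is a constant minus the cut-off of \<open>g\<close>, and the
      unkilled form ignores constants.\<close>
    have Dal: "form 0 True m al \<le> 2 * form 1 True m g"
    proof -
      have "form 0 True m al = form 0 True m (\<lambda>a. - 1 * (if facil True a then 0 else g a))"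
        unfolding al_def diff_conv_add_uminus form_shift by simp
      also have "\<dots> = form 0 True m (\<lambda>a. if facil True a then 0 else g a)"
        unfolding form_scale by simp
      finally show ?thesis using form_vanish_on_zero_le[of True m g] by simp
    qed
    have "mean n (\<lambda>b. form 0 True m (\<lambda>a. f (a @ b))) = mean n (\<lambda>b. (h b - e b)\<^sup>2 * form 0 True m al)"
    proof (rule mean_cong)
      fix b
      have "form 0 True m (\<lambda>a. f (a @ b)) = form 0 True m (\<lambda>a. e b + (h b - e b) * al a)"
        by (rule form_cong) (rule fa)
      then show "form 0 True m (\<lambda>a. f (a @ b)) = (h b - e b)\<^sup>2 * form 0 True m al"
        by (simp only: form_shift form_scale)
    qed
    also have "\<dots> = form 0 True m al * mean n (\<lambda>b. (h b - e b)\<^sup>2)"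
      unfolding mean_cmult[symmetric] by (simp only: mult.commute)
    also have "\<dots> \<le> (2 * form 1 True m g) * (q * real n)"
    proof (rule mult_mono[OF Dal])
      \<comment> \<open>\<open>h\<close> and \<open>e\<close> agree at all-ones, so only right
        blocks with a 0 count.\<close>
      show "mean n (\<lambda>b. (h b - e b)\<^sup>2) \<le> q * real n"
      proof (rule mean_off_ones)
        fix b
        have "\<bar>h b - e b\<bar> \<le> 1" using e[of b] admD(1,2)[OF g(2), of b] by linarith
        then show "(h b - e b)\<^sup>2 \<le> 1" by (simp add: abs_square_le_1)
      qed (simp add: e_def admD(3)[OF g(2)])
    qed (auto intro: mean_nonneg form_nonneg)
    finally have 1: "mean n (\<lambda>b. form 0 True m (\<lambda>a. f (a @ b))) \<le> 2 * q * real n * form 1 True m g"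
      by (simp only: mult_ac)
    have "mean m (\<lambda>a. form 1 (facil True a) n (\<lambda>b. f (a @ b))) \<le> mean m (\<lambda>a. form 1 True n h * (al a)\<^sup>2)"
    proof (rule mean_mono)
      fix a :: "bool list" assume a: "length a = m"
      show "form 1 (facil True a) n (\<lambda>b. f (a @ b)) \<le> form 1 True n h * (al a)\<^sup>2"
      proof (cases "facil True a")
        case True
        then have "al a = 1" unfolding al_def by simp
        then show ?thesis using True a by (simp add: fa)
      next
        case False
        \<comment> \<open>\<open>e\<close> is supported on the configuration frozen in an
          unfacilitated block, so it drops out.\<close>
        have "form 1 False n (\<lambda>b. f (a @ b)) = form 1 False n (\<lambda>b. al a * h b)"
          by (rule form_off_ones) (simp add: fa[OF a] e_def)
        also have "\<dots> \<le> (al a)\<^sup>2 * form 1 True n h"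
          unfolding form_scale by (intro mult_left_mono form_False_le) auto
        finally show ?thesis using False by (simp add: mult.commute)
      qed
    qed
    also have "\<dots> \<le> form 1 True n h * (q * real m)"
      unfolding mean_cmult
    proof (rule mult_left_mono)
      show "mean m (\<lambda>a. (al a)\<^sup>2) \<le> q * real m"
        by (rule mean_off_ones) (use al al1 in \<open>auto simp: power_le_one\<close>)
    qed (simp add: form_nonneg)
    finally have "mean m (\<lambda>a. form 1 (facil True a) n (\<lambda>b. f (a @ b))) \<le> q * real m * form 1 True n h"
      by (simp only: mult_ac)
    with 1 show ?thesis unfolding form_append by linarith
  qed
  ultimately show ?thesis by blast
qed

section \<open>The capacity and its decay under doubling\<close>

definition cap :: "nat \<Rightarrow> real" where
  "cap n = Inf (form 1 True n ` adm n)"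

lemma one_adm: "(\<lambda>_. 1) \<in> adm n"
  unfolding adm_def by simp

lemma cap_le: "g \<in> adm n \<Longrightarrow> cap n \<le> form 1 True n g"
  unfolding cap_def by (rule cInf_lower) (auto intro!: bdd_belowI[of _ 0] form_nonneg)

lemma le_capI: "(\<And>g. g \<in> adm n \<Longrightarrow> x \<le> form 1 True n g) \<Longrightarrow> x \<le> cap n"
  unfolding cap_def by (rule cInf_greatest) (use one_adm in auto)

lemma cap_0: "cap 0 \<le> 1"
  using cap_le[OF one_adm, of 0] by simp

lemma cap_1: "cap 1 \<le> q"
proof -
  have "(\<lambda>s. if s = [True] then 1 else 0) \<in> adm 1" unfolding adm_def by simp
  from cap_le[OF this] have "cap 1 \<le> (1 - q) * q" by simp
  also have "\<dots> \<le> 1 * q" by (rule mult_right_mono) (use q0 in auto)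
  finally show ?thesis by simp
qed

text \<open>Only positivity is at stake, so the crude \<open>n < 2 ^ n\<close> in
  \<open>form_dyadic\<close> is enough, together with the mass \<open>(1 - q) ^ n\<close> of
  all-ones.\<close>

lemma cap_pos: "0 < cap n"
proof -
  have "(q / 3) ^ n * (1 - q) ^ n \<le> cap n"
  proof (rule le_capI)
    fix g assume g: "g \<in> adm n"
    have "(q / 3) ^ n * (1 - q) ^ n \<le> (q / 3) ^ n * mean n (\<lambda>s. (g s)\<^sup>2)"
      using mean_ge_ones[of "\<lambda>s. (g s)\<^sup>2" n] admD(3)[OF g] q0 by (intro mult_left_mono) auto
    also have "\<dots> \<le> form 1 True n g" by (rule form_dyadic) simp
    finally show "(q / 3) ^ n * (1 - q) ^ n \<le> form 1 True n g" .
  qed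
  moreover have "0 < (q / 3) ^ n * (1 - q) ^ n" using q0 q1 by simp
  ultimately show ?thesis by linarith
qed

text \<open>A competitor extends by ignoring a new first site; its energy can only fall, since the
  old box is then facilitated only part of the time.\<close>

lemma cap_antimono: "m \<le> n \<Longrightarrow> cap n \<le> cap m"
proof (induction n rule: dec_induct)
  case (step n)
  have "cap (Suc n) \<le> cap n"
  proof (rule le_capI)
    fix g assume g: "g \<in> adm n"
    have "(\<lambda>s. g (tl s)) \<in> adm (Suc n)" using g unfolding adm_def by simp
    from cap_le[OF this] have "cap (Suc n) \<le> (1 - q) * form 1 False n g + q * form 1 True n g"
      by simp
    also have "\<dots> \<le> (1 - q) * form 1 True n g + q * form 1 True n g"
      by (intro add_mono mult_left_mono form_False_le order_refl) (use q1 in auto)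
    finally show "cap (Suc n) \<le> form 1 True n g" by (simp add: algebra_simps)
  qed
  with step show ?case by linarith
qed simp

lemma cap_double:
  assumes "0 < n"
  shows "cap (2 * n) \<le> 3 * q * real n * cap n"
proof -
  have pos: "0 < 3 * q * real n" using assms q0 by simp
  have "cap (2 * n) / (3 * q * real n) \<le> cap n"
  proof (rule le_capI)
    fix g assume g: "g \<in> adm n"
    obtain f where f: "f \<in> adm (n + n)"
      and le: "form 1 True (n + n) f \<le> 2 * q * real n * form 1 True n g + q * real n * form 1 True n g"
      using form_concat[OF g g assms] by (elim bexE)
    have "cap (n + n) \<le> 2 * q * real n * form 1 True n g + q * real n * form 1 True n g"
      using cap_le[OF f] le by (rule order_trans)
    also have "\<dots> = form 1 True n g * (3 * q * real n)"
      by (simp only: mult_ac)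
    finally show "cap (2 * n) / (3 * q * real n) \<le> form 1 True n g"
      unfolding pos_divide_le_eq[OF pos] mult_2 .
  qed
  then show ?thesis unfolding pos_divide_le_eq[OF pos] by (simp only: mult.commute)
qed

text \<open>Doubling from \<open>2 ^ j * n\<close> costs the factor 3 q 2^j n; all \<open>m\<close>
  factors are bounded by 3 q 2^m n to get a closed form.\<close>

lemma cap_dyadic:
  assumes "0 < n"
  shows "cap (2 ^ m * n) \<le> (3 * 2 ^ m * q * real n) ^ m * cap n"
proof (induction m)
  case (Suc m)
  let ?x = "3 * 2 ^ m * q * real n"
  have x: "0 \<le> ?x" using q0 by simp
  have "cap (2 ^ Suc m * n) \<le> 3 * q * real (2 ^ m * n) * cap (2 ^ m * n)"
    using cap_double[of "2 ^ m * n"] assms by (simp add: mult.assoc)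
  also have "\<dots> = ?x * cap (2 ^ m * n)" by simp
  also have "\<dots> \<le> ?x * (?x ^ m * cap n)" by (rule mult_left_mono[OF Suc.IH x])
  also have "\<dots> = ?x ^ Suc m * cap n" by simp
  also have "\<dots> \<le> (3 * 2 ^ Suc m * q * real n) ^ Suc m * cap n"
    using cap_pos[of n] x q0 by (intro mult_right_mono power_mono) auto
  finally show ?case .
qed simp

section \<open>The spectral gap\<close>

definition ones :: "bool list \<Rightarrow> nat set" where
  "ones s = {i \<in> {1..length s}. s ! (i - 1)}"

lemma ones_Nil [simp]: "ones [] = {}"
  unfolding ones_def by simp

lemma ones_subset: "ones s \<subseteq> {1..length s}"
  unfolding ones_def by auto

lemma ones_snoc: "ones (s @ [x]) = (if x then insert (Suc (length s)) (ones s) else ones s)"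
proof (rule set_eqI)
  fix i
  consider "i = 0" | "i = Suc (length s)" | "1 \<le> i" "i \<le> length s" | "Suc (length s) < i" by linarith
  then show "i \<in> ones (s @ [x]) \<longleftrightarrow> i \<in> (if x then insert (Suc (length s)) (ones s) else ones s)"
  proof cases
    case 3
    then have "i - 1 < length s" by linarith
    with 3 show ?thesis unfolding ones_def by (simp add: nth_append)
  qed (simp_all add: ones_def)
qed

text \<open>A left inverse of \<open>ones\<close>, through which functions of lists become functions
  of sets of sites.\<close>

lemma ones_map: "length s = n \<Longrightarrow> map (\<lambda>i. i \<in> ones s) [1..<Suc n] = s"
  by (rule nth_equalityI) (auto simp: ones_def simp del: upt_Suc)

lemma east_mean_Suc:
  "east_mean q (Suc L) f = (1 - q) * east_mean q L (\<lambda>\<sigma>. f (insert (Suc L) \<sigma>)) + q * east_mean q L f"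
proof -
  let ?C = "east_configs L"
  have sub: "\<sigma> \<subseteq> {1..L}" "finite \<sigma>" "card \<sigma> \<le> L" "Suc L \<notin> \<sigma>" if "\<sigma> \<in> ?C" for \<sigma>
    using that card_mono[of "{1..L}" \<sigma>] by (auto simp: east_configs_def intro: finite_subset)
  have C: "east_configs (Suc L) = ?C \<union> insert (Suc L) ` ?C"
    unfolding east_configs_def by (simp add: atLeastAtMostSuc_conv Pow_insert)
  have fin: "finite ?C" unfolding east_configs_def by simp
  have inj: "inj_on (insert (Suc L)) ?C" by (rule inj_onI) (metis insert_ident sub(4))
  have "east_mean q (Suc L) f = (\<Sum>\<sigma>\<in>?C. east_pi q (Suc L) \<sigma> * f \<sigma>)
      + (\<Sum>\<sigma>\<in>insert (Suc L) ` ?C. east_pi q (Suc L) \<sigma> * f \<sigma>)"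
    unfolding east_mean_def C
  proof (rule sum.union_disjoint)
    show "?C \<inter> insert (Suc L) ` ?C = {}" using sub(4) by blast
  qed (use fin in auto)
  also have "(\<Sum>\<sigma>\<in>insert (Suc L) ` ?C. east_pi q (Suc L) \<sigma> * f \<sigma>)
      = (\<Sum>\<sigma>\<in>?C. (1 - q) * (east_pi q L \<sigma> * f (insert (Suc L) \<sigma>)))"
    unfolding sum.reindex[OF inj] by (rule sum.cong) (auto simp: east_pi_def sub)
  also have "(\<Sum>\<sigma>\<in>?C. east_pi q (Suc L) \<sigma> * f \<sigma>) = (\<Sum>\<sigma>\<in>?C. q * (east_pi q L \<sigma> * f \<sigma>))"
    by (rule sum.cong) (auto simp: east_pi_def sub Suc_diff_le)
  finally show ?thesis unfolding east_mean_def sum_distrib_left by simp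
qed

lemma east_mean_eq: "east_mean q L f = mean L (\<lambda>s. f (ones s))"
proof (induction L arbitrary: f)
  case 0
  then show ?case by (simp add: east_mean_def east_configs_def east_pi_def)
next
  case (Suc L)
  have "mean L (\<lambda>s. f (ones (s @ [True]))) = mean L (\<lambda>s. f (insert (Suc L) (ones s)))"
    by (rule mean_cong) (simp add: ones_snoc)
  then show ?case unfolding east_mean_Suc mean_snoc Suc.IH by (simp add: ones_snoc)
qed

lemma east_var_eq:
  "east_var q L f = mean L (\<lambda>s. (f (ones s))\<^sup>2) - (mean L (\<lambda>s. f (ones s)))\<^sup>2"
proof -
  have "east_var q L f = east_mean q L (\<lambda>\<sigma>. (f \<sigma> - east_mean q L f)\<^sup>2)"
    unfolding east_var_def east_mean_def ..
  then show ?thesis unfolding east_mean_eq by (simp only: variance_eq)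
qed

lemma east_local_var_eq: "east_local_var q x f \<sigma> = (1 - q) * q * (f (insert x \<sigma>) - f (\<sigma> - {x}))\<^sup>2"
  unfolding east_local_var_def Let_def by (simp add: power2_eq_square algebra_simps)

text \<open>The flag \<open>True\<close> acts as a fixed 0 to the left of site 1, matching the
  unconstrained first site.\<close>

lemma east_c_ones: "east_c (Suc (length s)) (ones s) = (if facil True s then 1 else 0)"
proof (cases s rule: rev_cases)
  case Nil
  then show ?thesis by (simp add: east_c_def)
next
  case (snoc t x)
  have "Suc (length t) \<in> ones (t @ [x]) \<longleftrightarrow> x"
    using ones_subset[of t] by (auto simp: ones_snoc)
  then show ?thesis using snoc by (simp add: east_c_def)
qed

text \<open>Induction at the right end, because constraints look left: sites up to \<open>L\<close>
  do not notice site \<open>L + 1\<close>, so conditioning on it averages two smaller forms, and its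
  own flips give the last term of \<open>form_snoc\<close>.\<close>

lemma east_dirichlet_eq: "east_dirichlet q L f = form 0 True L (\<lambda>s. f (ones s))"
proof (induction L arbitrary: f)
  case 0
  then show ?case by (simp add: east_dirichlet_def)
next
  case (Suc L)
  let ?f = "\<lambda>\<sigma>. f (insert (Suc L) \<sigma>)"
  have D: "east_dirichlet q n h = (\<Sum>x\<in>{1..n}. east_mean q n (\<lambda>\<sigma>. east_c x \<sigma> * east_local_var q x h \<sigma>))" for n h
    unfolding east_dirichlet_def east_mean_def ..
  have inner: "east_mean q (Suc L) (\<lambda>\<sigma>. east_c x \<sigma> * east_local_var q x f \<sigma>)
      = (1 - q) * east_mean q L (\<lambda>\<sigma>. east_c x \<sigma> * east_local_var q x ?f \<sigma>)
        + q * east_mean q L (\<lambda>\<sigma>. east_c x \<sigma> * east_local_var q x f \<sigma>)" if "x \<in> {1..L}" for x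
  proof -
    have "east_c x (insert (Suc L) \<sigma>) = east_c x \<sigma>" for \<sigma>
      unfolding east_c_def using that by auto
    moreover have "east_local_var q x f (insert (Suc L) \<sigma>) = east_local_var q x ?f \<sigma>" for \<sigma>
    proof -
      have "insert (Suc L) \<sigma> - {x} = insert (Suc L) (\<sigma> - {x})" using that by auto
      then show ?thesis unfolding east_local_var_eq by (simp add: insert_commute)
    qed
    ultimately show ?thesis unfolding east_mean_Suc by simp
  qed
  have last: "east_mean q (Suc L) (\<lambda>\<sigma>. east_c (Suc L) \<sigma> * east_local_var q (Suc L) f \<sigma>)
      = (1 - q) * q * mean L (\<lambda>a. if facil True a then (f (ones (a @ [True])) - f (ones (a @ [False])))\<^sup>2 else 0)"
  proof -
    let ?h = "\<lambda>\<sigma>. east_c (Suc L) \<sigma> * east_local_var q (Suc L) f \<sigma>"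
    \<comment> \<open>Neither the constraint nor the local variance at a site depends on the spin
      there.\<close>
    have "?h (insert (Suc L) \<sigma>) = ?h \<sigma>" for \<sigma>
      unfolding east_local_var_eq by (simp add: east_c_def)
    then have "east_mean q (Suc L) ?h = east_mean q L ?h"
      unfolding east_mean_Suc by (simp add: algebra_simps)
    also have "\<dots> = mean L (\<lambda>a. (1 - q) * q * (if facil True a then (f (ones (a @ [True])) - f (ones (a @ [False])))\<^sup>2 else 0))"
      unfolding east_mean_eq
    proof (rule mean_cong)
      fix a :: "bool list" assume a: "length a = L"
      have "ones a - {Suc L} = ones a" using ones_subset[of a] a by auto
      then show "?h (ones a) = (1 - q) * q * (if facil True a then (f (ones (a @ [True])) - f (ones (a @ [False])))\<^sup>2 else 0)"
        using east_c_ones[of a] a by (simp add: east_local_var_eq ones_snoc)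
    qed
    finally show ?thesis by (simp only: mean_cmult)
  qed
  have ins: "form 0 True L (\<lambda>a. f (ones (a @ [True]))) = form 0 True L (\<lambda>a. ?f (ones a))"
    by (rule form_cong) (simp add: ones_snoc)
  have "east_dirichlet q (Suc L) f
      = (\<Sum>x\<in>{1..L}. east_mean q (Suc L) (\<lambda>\<sigma>. east_c x \<sigma> * east_local_var q x f \<sigma>))
        + east_mean q (Suc L) (\<lambda>\<sigma>. east_c (Suc L) \<sigma> * east_local_var q (Suc L) f \<sigma>)"
    unfolding D by simp
  also have "(\<Sum>x\<in>{1..L}. east_mean q (Suc L) (\<lambda>\<sigma>. east_c x \<sigma> * east_local_var q x f \<sigma>))
      = (1 - q) * east_dirichlet q L ?f + q * east_dirichlet q L f"
    unfolding D sum_distrib_left sum.distrib[symmetric] by (rule sum.cong[OF refl inner])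
  finally show ?case unfolding form_snoc last Suc.IH ins by (simp add: ones_snoc)
qed

lemma east_var_nonneg: "0 \<le> east_var q L f"
  unfolding east_var_eq using mean_square_le[of L "\<lambda>s. f (ones s)"] by simp

text \<open>The witness is \<open>(1{last site is 0} - q) g\<close>; on such functions the generator on \<open>N + 1\<close> sites
  acts as the generator on \<open>N\<close> sites killed at rate one on a last zero.\<close>

lemma last_site_function:
  obtains f where "east_var q (Suc N) f = (1 - q) * q * mean N (\<lambda>s. (g s)\<^sup>2)"
    and "east_dirichlet q (Suc N) f = (1 - q) * q * form 1 True N g"
proof
  \<comment> \<open>Under the last spin the prefactor has mean 0 and mean square
    \<open>(1 - q) * q\<close>.\<close>
  let ?G = "\<lambda>s. (if last s then - q else 1 - q) * g (butlast s)"
  let ?f = "\<lambda>\<sigma>. ?G (map (\<lambda>i. i \<in> \<sigma>) [1..<Suc (Suc N)])"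
  have f: "?f (ones s) = ?G s" if "length s = Suc N" for s
    using ones_map[OF that] by simp
  have "mean (Suc N) (\<lambda>s. ?f (ones s)) = mean (Suc N) ?G"
    by (rule mean_cong) (rule f)
  also have "\<dots> = 0"
    unfolding mean_snoc using mean_cmult[of N q g] mean_cmult[of N "- q" g] mean_cmult[of N "1 - q" g]
    by simp
  finally have m0: "mean (Suc N) (\<lambda>s. ?f (ones s)) = 0" .
  have "mean (Suc N) (\<lambda>s. (?f (ones s))\<^sup>2) = mean (Suc N) (\<lambda>s. (?G s)\<^sup>2)"
    by (rule mean_cong) (simp only: f)
  also have "\<dots> = (1 - q) * (q\<^sup>2 * mean N (\<lambda>s. (g s)\<^sup>2)) + q * ((1 - q)\<^sup>2 * mean N (\<lambda>s. (g s)\<^sup>2))"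
    unfolding mean_snoc by (simp add: power_mult_distrib mean_cmult)
  also have "\<dots> = (1 - q) * q * mean N (\<lambda>s. (g s)\<^sup>2)"
    by (simp add: power2_eq_square algebra_simps)
  finally show "east_var q (Suc N) ?f = (1 - q) * q * mean N (\<lambda>s. (g s)\<^sup>2)"
    unfolding east_var_eq m0 by simp
  have "east_dirichlet q (Suc N) ?f = form 0 True (Suc N) ?G"
    unfolding east_dirichlet_eq by (rule form_cong) (rule f)
  also have "\<dots> = (1 - q) * form 0 True N (\<lambda>s. - q * g s) + q * form 0 True N (\<lambda>s. (1 - q) * g s)
      + (1 - q) * q * mean N (\<lambda>a. if facil True a then (- q * g a - (1 - q) * g a)\<^sup>2 else 0)"
    unfolding form_snoc by (simp cong: if_cong)
  \<comment> \<open>Flipping the last spin changes the function by \<open>g\<close> up to sign; this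
    is the killing at rate one.\<close>
  also have "(\<lambda>a. if facil True a then (- q * g a - (1 - q) * g a)\<^sup>2 else 0) = (\<lambda>a. if facil True a then (g a)\<^sup>2 else 0)"
    by (rule ext) (simp add: algebra_simps)
  also have "(1 - q) * form 0 True N (\<lambda>s. - q * g s) + q * form 0 True N (\<lambda>s. (1 - q) * g s)
      = (1 - q) * q * form 0 True N g"
    unfolding form_scale by (simp add: power2_eq_square algebra_simps)
  finally show "east_dirichlet q (Suc N) ?f = (1 - q) * q * form 1 True N g"
    unfolding form_kill_eq[of 1] by (simp add: distrib_left)
qed

text \<open>The Rayleigh quotient of the function from \<open>last_site_function\<close>; the mass
  of all-ones bounds the mean square of \<open>g\<close> from below.\<close>

lemma gap_le:
  assumes "g \<in> adm N"
  shows "east_gap q (Suc N) \<le> form 1 True N g / (1 - q) ^ N"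
proof -
  obtain f where f: "east_var q (Suc N) f = (1 - q) * q * mean N (\<lambda>s. (g s)\<^sup>2)"
    "east_dirichlet q (Suc N) f = (1 - q) * q * form 1 True N g" by (rule last_site_function)
  have m: "(1 - q) ^ N \<le> mean N (\<lambda>s. (g s)\<^sup>2)"
    using mean_ge_ones[of "\<lambda>s. (g s)\<^sup>2" N] admD(3)[OF assms] by simp
  have p: "0 < (1 - q) ^ N" using q1 by simp
  have "east_gap q (Suc N) \<le> east_dirichlet q (Suc N) f / east_var q (Suc N) f"
    unfolding east_gap_def
  proof (rule cInf_lower)
    show "bdd_below {east_dirichlet q (Suc N) f / east_var q (Suc N) f |f. east_var q (Suc N) f \<noteq> 0}"
    proof (rule bdd_belowI[of _ 0])
      fix x assume "x \<in> {east_dirichlet q (Suc N) f / east_var q (Suc N) f |f. east_var q (Suc N) f \<noteq> 0}"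
      then obtain h where x: "x = east_dirichlet q (Suc N) h / east_var q (Suc N) h" by auto
      show "0 \<le> x" unfolding x east_dirichlet_eq
        by (intro divide_nonneg_nonneg form_nonneg east_var_nonneg) simp
    qed
    have "mean N (\<lambda>s. (g s)\<^sup>2) \<noteq> 0" using m p by linarith
    then have "east_var q (Suc N) f \<noteq> 0" unfolding f(1) using q0 q1 by simp
    then show "east_dirichlet q (Suc N) f / east_var q (Suc N) f
        \<in> {east_dirichlet q (Suc N) f / east_var q (Suc N) f |f. east_var q (Suc N) f \<noteq> 0}" by blast
  qed
  also have "\<dots> = form 1 True N g / mean N (\<lambda>s. (g s)\<^sup>2)"
    unfolding f using q0 q1 by simp
  also have "\<dots> \<le> form 1 True N g / (1 - q) ^ N"
    by (rule divide_left_mono[OF m]) (use m p in \<open>auto intro: form_nonneg mult_pos_pos\<close>)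
  finally show ?thesis .
qed

lemma le_gap:
  assumes "0 \<le> r" "\<And>m g. m \<le> N \<Longrightarrow> r * mean m (\<lambda>s. (g s)\<^sup>2) \<le> form 1 True m g"
  shows "r \<le> east_gap q (Suc N)"
  unfolding east_gap_def
proof (rule cInf_greatest)
  \<comment> \<open>Some function must have nonzero variance, lest the infimum range over the empty
    set; the one built from the constant 1 does.\<close>
  obtain f where "east_var q (Suc N) f = (1 - q) * q * mean N (\<lambda>s. (1 :: real)\<^sup>2)"
    by (rule last_site_function)
  then have "east_var q (Suc N) f \<noteq> 0" using q0 q1 by simp
  then show "{east_dirichlet q (Suc N) f / east_var q (Suc N) f |f. east_var q (Suc N) f \<noteq> 0} \<noteq> {}"
    by blast
next
  fix x assume "x \<in> {east_dirichlet q (Suc N) f / east_var q (Suc N) f |f. east_var q (Suc N) f \<noteq> 0}"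
  then obtain f where f: "x = east_dirichlet q (Suc N) f / east_var q (Suc N) f" "east_var q (Suc N) f \<noteq> 0"
    by auto
  then have pos: "0 < east_var q (Suc N) f" using east_var_nonneg[of "Suc N" f] by linarith
  have "r * east_var q (Suc N) f \<le> east_dirichlet q (Suc N) f"
    unfolding east_var_eq east_dirichlet_eq by (rule poincare) (use assms in auto)
  then show "r \<le> x" unfolding f(1) pos_le_divide_eq[OF pos] .
qed

lemma cap_le_gap: "cap N / (real N + 1) \<le> east_gap q (Suc N)"
proof (rule le_gap)
  show "0 \<le> cap N / (real N + 1)" using cap_pos[of N] by simp
  fix m g assume m: "m \<le> N"
  have "cap N / (real N + 1) * mean m (\<lambda>s. (g s)\<^sup>2) \<le> cap N / (real m + 1) * mean m (\<lambda>s. (g s)\<^sup>2)"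
    using m cap_pos[of N] by (intro mult_right_mono mean_nonneg divide_left_mono) auto
  also have "\<dots> \<le> form 1 True m g"
    by (rule capacity_poincare[OF cap_pos order_trans[OF cap_antimono cap_le] m])
  finally show "cap N / (real N + 1) * mean m (\<lambda>s. (g s)\<^sup>2) \<le> form 1 True m g" .
qed

text \<open>Makes \<open>T_rel\<close> a true reciprocal rather than the default value of division
  by zero.\<close>

lemma gap_pos: "0 < east_gap q (Suc N)"
  using cap_le_gap[of N] cap_pos[of N] divide_pos_pos[of "cap N" "real N + 1"] by linarith

section \<open>Bounds on the relaxation time\<close>

lemma T_rel_pos: "0 < T_rel q (Suc N)"
  unfolding T_rel_def using gap_pos[of N] by simp

lemma T_rel_le_cap: "T_rel q (Suc N) \<le> (real N + 1) / cap N"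
proof -
  have "1 / east_gap q (Suc N) \<le> 1 / (cap N / (real N + 1))"
    using cap_le_gap[of N] gap_pos[of N] cap_pos[of N] by (intro divide_left_mono mult_pos_pos) auto
  then show ?thesis unfolding T_rel_def by simp
qed

lemma cap_le_T_rel: "(1 - q) ^ N / cap N \<le> T_rel q (Suc N)"
proof -
  have p: "0 < (1 - q) ^ N" using q1 by simp
  have "east_gap q (Suc N) * (1 - q) ^ N \<le> cap N"
    by (rule le_capI) (rule gap_le[where N = N, unfolded pos_le_divide_eq[OF p]])
  then show ?thesis unfolding T_rel_def using gap_pos[of N] cap_pos[of N] by (simp add: field_simps)
qed

lemma T_rel_dyadic_le: "Suc N \<le> 2 ^ n \<Longrightarrow> T_rel q (Suc N) \<le> (3 / q) ^ n"
proof -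
  assume N: "Suc N \<le> 2 ^ n"
  have "(q / 3) ^ n \<le> east_gap q (Suc N)"
    by (rule le_gap) (use N q0 in \<open>auto intro: form_dyadic\<close>)
  then have "1 / east_gap q (Suc N) \<le> 1 / (q / 3) ^ n"
    using gap_pos[of N] q0 by (intro divide_left_mono mult_pos_pos) auto
  then show ?thesis unfolding T_rel_def by (simp add: power_divide)
qed

text \<open>As \<open>2 ^ n \<le> N\<close>, it suffices to bound the capacity of 2^n sites, reached
  by \<open>n\<close> doublings of one site. Each doubling yields a factor \<open>q\<close> and the
  single site another, hence the exponent \<open>Suc n\<close>.\<close>

lemma T_rel_dyadic_ge:
  assumes "2 ^ n < Suc N" "q \<le> 1 / 2"
  shows "(1 / 2) ^ N / ((3 * 2 ^ n) ^ n * q ^ Suc n) \<le> T_rel q (Suc N)"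
proof -
  have "cap N \<le> cap (2 ^ n * 1)" by (rule cap_antimono) (use assms(1) in simp)
  also have "\<dots> \<le> (3 * 2 ^ n * q * real 1) ^ n * cap 1" by (rule cap_dyadic) simp
  also have "\<dots> \<le> (3 * 2 ^ n * q * real 1) ^ n * q"
    by (rule mult_left_mono[OF cap_1]) (use q0 in simp)
  also have "\<dots> = (3 * 2 ^ n) ^ n * q ^ Suc n" by (simp add: power_mult_distrib)
  finally have "(1 / 2) ^ N / ((3 * 2 ^ n) ^ n * q ^ Suc n) \<le> (1 - q) ^ N / cap N"
    using assms(2) cap_pos[of N] by (intro frac_le power_mono) auto
  then show ?thesis using cap_le_T_rel[of N] by linarith
qed

text \<open>Supplies the lower bound of order one for exponent 0, where no doubling is
  available.\<close>

lemma T_rel_ge_const: "q \<le> 1 / 2 \<Longrightarrow> (1 / 2) ^ N \<le> T_rel q (Suc N)"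
proof -
  assume "q \<le> 1 / 2"
  then have "(1 / 2) ^ N / 1 \<le> (1 - q) ^ N / cap N"
    using cap_pos[of N] cap_antimono[of 0 N] cap_0 by (intro frac_le power_mono) auto
  then show ?thesis using cap_le_T_rel[of N] by simp
qed

text \<open>With N = L - 1, the unknown \<open>cap N\<close> occurs in the bounds for both
  relaxation times and cancels in the ratio. Since \<open>2 \<le> L\<close>, this \<open>N\<close>
  is positive and can be doubled.\<close>

lemma T_rel_ratio_ge:
  assumes "2 \<le> L"
  shows "(1 - q) ^ (2 ^ m * L) / (real L * (3 * 2 ^ m * q * real L) ^ m) \<le> T_rel q (2 ^ m * L) / T_rel q L"
proof -
  define N where "N = L - 1"
  define K where "K = 2 ^ m * L - 1"
  have L: "L = Suc N" and N: "0 < N" using assms unfolding N_def by auto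
  have KL: "2 ^ m * L = Suc K" unfolding K_def using assms by simp
  let ?x = "(3 * 2 ^ m * q * real L) ^ m"
  \<comment> \<open>The shift by one is favourable: 2^m L - 1 is at least 2^m (L - 1), and
    capacities decrease with length.\<close>
  have "cap K \<le> cap (2 ^ m * N)"
  proof (rule cap_antimono)
    have "2 ^ m + 2 ^ m * N = Suc K" using KL L by simp
    moreover have "(1 :: nat) \<le> 2 ^ m" by simp
    ultimately show "2 ^ m * N \<le> K" by linarith
  qed
  also have "\<dots> \<le> (3 * 2 ^ m * q * real N) ^ m * cap N" by (rule cap_dyadic[OF N])
  also have "\<dots> \<le> ?x * cap N"
    using cap_pos[of N] q0 L by (intro mult_right_mono power_mono) auto
  finally have c: "cap K \<le> ?x * cap N" .
  have x: "0 < ?x" using q0 assms by simp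
  have "(1 - q) ^ (2 ^ m * L) / (real L * ?x) = ((1 - q) ^ Suc K / (?x * cap N)) / (real L / cap N)"
    unfolding KL using cap_pos[of N] by simp
  also have "\<dots> \<le> T_rel q (2 ^ m * L) / T_rel q L"
  proof (rule frac_le)
    have "(1 - q) ^ Suc K / (?x * cap N) \<le> (1 - q) ^ K / cap K"
      using c cap_pos[of K] q0 q1 by (intro frac_le power_decreasing) auto
    then show "(1 - q) ^ Suc K / (?x * cap N) \<le> T_rel q (2 ^ m * L)"
      using cap_le_T_rel[of K] unfolding KL by linarith
    show "T_rel q L \<le> real L / cap N" using T_rel_le_cap[of N] L by (simp add: add.commute)
  qed (use T_rel_pos KL L in \<open>auto intro: less_imp_le\<close>)
  finally show ?thesis .
qed

end

section \<open>Asymptotics for small q\<close>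

lemma succ_qI:
  assumes "0 < \<beta>" "0 < c" "eventually (\<lambda>q. c \<le> q powr \<beta> * (f q / h q)) (at_right 0)"
  shows "succ_q f h"
proof -
  have "0 < ereal c" using assms(2) by simp
  also have "ereal c \<le> Liminf (at_right 0) (\<lambda>q. ereal (q powr \<beta> * f q / h q))"
    by (rule Liminf_bounded)
      (rule eventually_mono[OF assms(3)], simp only: ereal_less_eq times_divide_eq_right)
  finally have "0 < Liminf (at_right 0) (\<lambda>q. ereal (q powr \<beta> * f q / h q))" .
  then show ?thesis unfolding succ_q_def using assms(1) by blast
qed

text \<open>A bounded ratio times any positive power of \<open>q\<close> is bounded above by
  something tending to 0.\<close>

lemma not_succ_qI:
  assumes "eventually (\<lambda>q. f q / h q \<le> c) (at_right 0)"
  shows "\<not> succ_q f h"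
proof
  assume "succ_q f h"
  then obtain \<beta> where b: "0 < \<beta>" "0 < Liminf (at_right 0) (\<lambda>q. ereal (q powr \<beta> * f q / h q))"
    unfolding succ_q_def by blast
  have "((\<lambda>q. q powr \<beta> * c) \<longlongrightarrow> 0 * c) (at_right (0::real))"
  proof (intro tendsto_mult tendsto_const)
    show "((\<lambda>q. q powr \<beta>) \<longlongrightarrow> 0) (at_right (0::real))"
      using b(1) by real_asymp
  qed
  then have lim: "((\<lambda>q. ereal (q powr \<beta> * c)) \<longlongrightarrow> ereal 0) (at_right 0)" by simp
  have "Liminf (at_right 0) (\<lambda>q. ereal (q powr \<beta> * f q / h q))
      \<le> Liminf (at_right 0) (\<lambda>q. ereal (q powr \<beta> * c))"
  proof (rule Liminf_mono)
    show "eventually (\<lambda>q. ereal (q powr \<beta> * f q / h q) \<le> ereal (q powr \<beta> * c)) (at_right 0)"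
      using assms
    proof eventually_elim
      case (elim q)
      have "q powr \<beta> * (f q / h q) \<le> q powr \<beta> * c" by (rule mult_left_mono[OF elim]) simp
      then show ?case by simp
    qed
  qed
  also have "\<dots> = 0" using lim_imp_Liminf[OF _ lim] by (simp add: zero_ereal_def)
  finally show False using b(2) by simp
qed

lemma ceiling_log2_bounds:
  assumes "1 \<le> L"
  obtains n where "\<lceil>log 2 (real L)\<rceil> = int n" "L \<le> 2 ^ n" "n = 0 \<or> (\<exists>k. n = Suc k \<and> 2 ^ k < L)"
proof
  define n where "n = nat \<lceil>log 2 (real L)\<rceil>"
  have "0 \<le> log 2 (real L)" using assms by simp
  then show c: "\<lceil>log 2 (real L)\<rceil> = int n" unfolding n_def by simp
  have "log 2 (real L) \<le> real n" using c le_of_int_ceiling[of "log 2 (real L)"] by simp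
  then have "real L \<le> 2 powr real n" using assms by (simp add: log_le_iff)
  then have "real L \<le> real (2 ^ n)" by (simp add: powr_realpow)
  then show "L \<le> 2 ^ n" by (simp only: of_nat_le_iff)
  show "n = 0 \<or> (\<exists>k. n = Suc k \<and> 2 ^ k < L)"
  proof (cases n)
    case (Suc k)
    have "real k < log 2 (real L)" using c Suc by linarith
    then have "2 powr real k < real L" using assms by (simp add: less_log_iff)
    then have "real (2 ^ k) < real L" by (simp add: powr_realpow)
    then have "2 ^ k < L" by (simp only: of_nat_less_iff)
    with Suc show ?thesis by blast
  qed simp
qed

text \<open>The constants do not depend on \<open>q\<close>. The upper bound rests on
  \<open>L \<le> 2 ^ n\<close>, the lower one on 2^(n - 1) < L, with \<open>n = 0\<close> treated
  apart.\<close>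

lemma T_rel_fixed_bounds:
  assumes "1 \<le> L" "\<lceil>log 2 (real L)\<rceil> = int n"
  shows "\<exists>c>0. \<forall>q. 0 < q \<longrightarrow> q < 1 / 2 \<longrightarrow> c / q ^ n \<le> T_rel q L \<and> T_rel q L \<le> 3 ^ n / q ^ n"
proof -
  obtain n' where n': "\<lceil>log 2 (real L)\<rceil> = int n'" "L \<le> 2 ^ n'" "n' = 0 \<or> (\<exists>k. n' = Suc k \<and> 2 ^ k < L)"
    by (rule ceiling_log2_bounds[OF assms(1)])
  then have n: "L \<le> 2 ^ n" "n = 0 \<or> (\<exists>k. n = Suc k \<and> 2 ^ k < L)" using assms(2) by auto
  obtain N where L: "L = Suc N" using assms(1) by (cases L) auto
  have up: "T_rel q L \<le> 3 ^ n / q ^ n" if "0 < q" "q < 1 / 2" for q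
    using T_rel_dyadic_le[of q N n] that n(1) L by (simp add: power_divide)
  have "\<exists>c>0. \<forall>q. 0 < q \<longrightarrow> q < 1 / 2 \<longrightarrow> c / q ^ n \<le> T_rel q L"
    using n(2)
  proof
    assume "n = 0"
    then show ?thesis using T_rel_ge_const[of _ N] L by (intro exI[of _ "(1 / 2) ^ N"]) auto
  next
    assume "\<exists>k. n = Suc k \<and> 2 ^ k < L"
    then obtain k where k: "n = Suc k" "2 ^ k < L" by blast
    show ?thesis
    proof (intro exI[of _ "(1 / 2) ^ N / (3 * 2 ^ k) ^ k"] conjI allI impI)
      fix q :: real assume "0 < q" "q < 1 / 2"
      then show "(1 / 2) ^ N / (3 * 2 ^ k) ^ k / q ^ n \<le> T_rel q L"
        using T_rel_dyadic_ge[of q k N] k L by simp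
    qed simp
  qed
  then show ?thesis using up by blast
qed

lemma eventually_half: "eventually (\<lambda>q::real. 0 < q \<and> q < 1 / 2) (at_right 0)"
  by (rule eventually_at_rightI[of 0 "1 / 2"]) auto

lemma succ_q_fixed_iff:
  assumes "1 \<le> L" "1 \<le> L'"
  shows "succ_q (\<lambda>q. T_rel q L') (\<lambda>q. T_rel q L) \<longleftrightarrow> \<lceil>log 2 (real L')\<rceil> > \<lceil>log 2 (real L)\<rceil>"
proof -
  obtain n where n: "\<lceil>log 2 (real L)\<rceil> = int n" by (rule ceiling_log2_bounds[OF assms(1)])
  obtain n' where n': "\<lceil>log 2 (real L')\<rceil> = int n'" by (rule ceiling_log2_bounds[OF assms(2)])
  obtain c where c: "0 < c"
    "\<forall>q. 0 < q \<longrightarrow> q < 1 / 2 \<longrightarrow> c / q ^ n \<le> T_rel q L \<and> T_rel q L \<le> 3 ^ n / q ^ n"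
    using T_rel_fixed_bounds[OF assms(1) n] by blast
  obtain c' where c': "0 < c'"
    "\<forall>q. 0 < q \<longrightarrow> q < 1 / 2 \<longrightarrow> c' / q ^ n' \<le> T_rel q L' \<and> T_rel q L' \<le> 3 ^ n' / q ^ n'"
    using T_rel_fixed_bounds[OF assms(2) n'] by blast
  show ?thesis
  proof (cases "n < n'")
    case True
    \<comment> \<open>The gap between the two exponents is the \<beta> of
      \<open>succ_q\<close>.\<close>
    define k where "k = n' - n"
    have k: "n' = n + k" "0 < k" using True unfolding k_def by auto
    have "succ_q (\<lambda>q. T_rel q L') (\<lambda>q. T_rel q L)"
    proof (rule succ_qI)
      show "0 < real k" "0 < c' / 3 ^ n" using k c'(1) by auto
      show "eventually (\<lambda>q. c' / 3 ^ n \<le> q powr real k * (T_rel q L' / T_rel q L)) (at_right 0)"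
        using eventually_half
      proof eventually_elim
        case (elim q)
        have "c' / 3 ^ n = q ^ k * ((c' / q ^ n') / (3 ^ n / q ^ n))"
          using elim by (simp add: k(1) power_add field_simps)
        also have "\<dots> \<le> q ^ k * (T_rel q L' / T_rel q L)"
        proof (intro mult_left_mono frac_le)
          have "0 < c / q ^ n" using elim c(1) by simp
          then show "0 < T_rel q L" using c(2)[rule_format, of q] elim by linarith
          have "0 < c' / q ^ n'" using elim c'(1) by simp
          then show "0 \<le> T_rel q L'" using c'(2)[rule_format, of q] elim by linarith
        qed (use elim c(2)[rule_format, of q] c'(2)[rule_format, of q] in auto)
        finally show ?case using elim by (simp add: powr_realpow)
      qed
    qed
    then show ?thesis using True n n' by simp
  next
    case False
    define k where "k = n - n'"
    have k: "n = n' + k" using False unfolding k_def by auto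
    have "\<not> succ_q (\<lambda>q. T_rel q L') (\<lambda>q. T_rel q L)"
    proof (rule not_succ_qI)
      show "eventually (\<lambda>q. T_rel q L' / T_rel q L \<le> 3 ^ n' / c) (at_right 0)"
        using eventually_half
      proof eventually_elim
        case (elim q)
        have "T_rel q L' / T_rel q L \<le> (3 ^ n' / q ^ n') / (c / q ^ n)"
          using elim c'(2)[rule_format, of q] c(2)[rule_format, of q] c(1) by (intro frac_le) auto
        also have "\<dots> = 3 ^ n' / c * q ^ k"
          using elim c(1) by (simp add: k power_add field_simps)
        also have "\<dots> \<le> 3 ^ n' / c * 1"
          using elim c(1) by (intro mult_left_mono power_le_one) auto
        finally show ?case by simp
      qed
    qed
    then show ?thesis using False n n' by simp
  qed
qed

text \<open>With L of order q^(-\<gamma>), the denominator L (q L)^m in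
  \<open>T_rel_ratio_ge\<close> is of order q^\<beta> for \<beta> = m (1 - \<gamma>) - \<gamma>,
  positive by assumption; \<open>K\<close> collects the constants.\<close>

lemma succ_q_mesoscopic:
  assumes g: "0 < \<gamma>" "\<gamma> < 1" and m: "\<gamma> < real m * (1 - \<gamma>)" and d: "0 < d"
  shows "succ_q (\<lambda>q. T_rel q (2 ^ m * nat \<lfloor>d / q powr \<gamma>\<rfloor>)) (\<lambda>q. T_rel q (nat \<lfloor>d / q powr \<gamma>\<rfloor>))"
proof -
  define \<beta> where "\<beta> = real m * (1 - \<gamma>) - \<gamma>"
  define K where "K = d * (3 * 2 ^ m * d) ^ m"
  have K: "0 < K" unfolding K_def using d by simp
  \<comment> \<open>Ensures that the box has at least two sites, as \<open>T_rel_ratio_ge\<close>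
    demands.\<close>
  have lim1: "eventually (\<lambda>q. 2 \<le> d / q powr \<gamma>) (at_right 0)"
  proof -
    have "filterlim (\<lambda>q. d / q powr \<gamma>) at_top (at_right 0)" using g d by real_asymp
    then show ?thesis unfolding filterlim_at_top by blast
  qed
  \<comment> \<open>Makes the expected number of zeros in the larger box less than 1/2, so that
    Bernoulli's inequality keeps its all-ones probability at least 1/2.\<close>
  have lim2: "eventually (\<lambda>q. 2 ^ m * (d * q powr (1 - \<gamma>)) < 1 / 2) (at_right 0)"
  proof (rule order_tendstoD(2))
    have "((\<lambda>q. q powr (1 - \<gamma>)) \<longlongrightarrow> 0) (at_right (0::real))" using g by real_asymp
    then show "((\<lambda>q. 2 ^ m * (d * q powr (1 - \<gamma>))) \<longlongrightarrow> 0) (at_right 0)"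
      by (intro tendsto_mult_right_zero)
  qed simp
  show ?thesis
  proof (rule succ_qI)
    show "0 < \<beta>" unfolding \<beta>_def using m by simp
    show "0 < 1 / (2 * K)" using K by simp
    show "eventually (\<lambda>q. 1 / (2 * K) \<le> q powr \<beta> *
        (T_rel q (2 ^ m * nat \<lfloor>d / q powr \<gamma>\<rfloor>) / T_rel q (nat \<lfloor>d / q powr \<gamma>\<rfloor>))) (at_right 0)"
      using lim1 lim2 eventually_half
    proof eventually_elim
      case (elim q)
      define L where "L = nat \<lfloor>d / q powr \<gamma>\<rfloor>"
      have q: "0 < q" "q < 1" using elim by auto
      have L2: "2 \<le> L" unfolding L_def using elim(1) by linarith
      have Lx: "real L \<le> d / q powr \<gamma>" unfolding L_def using elim(1) by linarith
      have qx: "q * (d / q powr \<gamma>) = d * q powr (1 - \<gamma>)"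
        using q by (simp add: powr_diff)
      have qL: "q * real L \<le> d * q powr (1 - \<gamma>)"
        unfolding qx[symmetric] by (rule mult_left_mono[OF Lx]) (use q in simp)
      have "2 ^ m * (q * real L) \<le> 2 ^ m * (d * q powr (1 - \<gamma>))" by (rule mult_left_mono[OF qL]) simp
      moreover have "real (2 ^ m * L) * q = 2 ^ m * (q * real L)" by simp
      ultimately have "1 / 2 \<le> 1 + real (2 ^ m * L) * (- q)" using elim(2) by linarith
      also have "\<dots> \<le> (1 + (- q)) ^ (2 ^ m * L)" by (rule Bernoulli_inequality) (use q in simp)
      finally have half: "1 / 2 \<le> (1 - q) ^ (2 ^ m * L)" by simp
      have "real L * (3 * 2 ^ m * q * real L) ^ m \<le> d / q powr \<gamma> * (3 * 2 ^ m * (d * q powr (1 - \<gamma>))) ^ m"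
      proof (intro mult_mono[OF Lx] power_mono)
        show "3 * 2 ^ m * q * real L \<le> 3 * 2 ^ m * (d * q powr (1 - \<gamma>))"
          using mult_left_mono[OF qL, of "3 * 2 ^ m"] by (simp add: mult.assoc)
      qed (use q d in auto)
      also have "\<dots> = K * ((q powr (1 - \<gamma>)) ^ m / q powr \<gamma>)"
        unfolding K_def by (simp add: power_mult_distrib mult_ac)
      also have "(q powr (1 - \<gamma>)) ^ m / q powr \<gamma> = q powr \<beta>"
        unfolding \<beta>_def powr_diff[of q "real m * (1 - \<gamma>)"] using q by (simp add: powr_power mult.commute)
      finally have den: "real L * (3 * 2 ^ m * q * real L) ^ m \<le> K * q powr \<beta>" .
      have "1 / (2 * K) = q powr \<beta> * ((1 / 2) / (K * q powr \<beta>))"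
        using q K by simp
      also have "\<dots> \<le> q powr \<beta> * ((1 - q) ^ (2 ^ m * L) / (real L * (3 * 2 ^ m * q * real L) ^ m))"
        using half den q L2 by (intro mult_left_mono frac_le) auto
      also have "\<dots> \<le> q powr \<beta> * (T_rel q (2 ^ m * L) / T_rel q L)"
        by (rule mult_left_mono[OF T_rel_ratio_ge[OF q L2]]) simp
      finally show ?case unfolding L_def .
    qed
  qed
qed

theorem mainTheorem3:
  shows "(\<forall>L L' :: nat. L \<ge> 1 \<longrightarrow> L' \<ge> 1 \<longrightarrow>
            (succ_q (\<lambda>q. T_rel q L') (\<lambda>q. T_rel q L) \<longleftrightarrow>
             \<lceil>log 2 (real L')\<rceil> > \<lceil>log 2 (real L)\<rceil>))
       \<and> (\<forall>\<gamma>::real. 0 < \<gamma> \<and> \<gamma> < 1 \<longrightarrow>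
            (\<exists>lam::real. lam > 1 \<and> (\<forall>d::real. d > 0 \<longrightarrow>
               succ_q (\<lambda>q. T_rel q (nat \<lfloor>lam * real (nat \<lfloor>d / q powr \<gamma>\<rfloor>)\<rfloor>))
                      (\<lambda>q. T_rel q (nat \<lfloor>d / q powr \<gamma>\<rfloor>)))))
       \<and> (\<forall>\<gamma>::real. 0 < \<gamma> \<and> \<gamma> < 1/2 \<longrightarrow>
            (\<forall>d::real. d > 0 \<longrightarrow>
               succ_q (\<lambda>q. T_rel q (nat \<lfloor>2 * real (nat \<lfloor>d / q powr \<gamma>\<rfloor>)\<rfloor>))
                      (\<lambda>q. T_rel q (nat \<lfloor>d / q powr \<gamma>\<rfloor>))))"
proof (intro conjI allI impI)
  fix L L' :: nat assume "1 \<le> L" "1 \<le> L'"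
  then show "succ_q (\<lambda>q. T_rel q L') (\<lambda>q. T_rel q L) \<longleftrightarrow> \<lceil>log 2 (real L')\<rceil> > \<lceil>log 2 (real L)\<rceil>"
    by (rule succ_q_fixed_iff)
next
  fix \<gamma> :: real assume g: "0 < \<gamma> \<and> \<gamma> < 1"
  \<comment> \<open>Since \<gamma> < 1, such an \<open>m\<close> exists; it fixes the factor 2^m
    before \<open>d\<close> is chosen.\<close>
  then obtain m where m: "\<gamma> < real m * (1 - \<gamma>)"
    using reals_Archimedean3[of "1 - \<gamma>"] by auto
  then have "m \<noteq> 0" using g by (intro notI) simp
  have "2 ^ m * real L = real (2 ^ m * L)" for L by simp
  \<comment> \<open>The product is an integer, so the floor changes nothing.\<close>
  then have nL: "nat \<lfloor>2 ^ m * real L\<rfloor> = 2 ^ m * L" for L by (simp only: floor_of_nat nat_int)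
  show "\<exists>lam::real. lam > 1 \<and> (\<forall>d::real. d > 0 \<longrightarrow>
      succ_q (\<lambda>q. T_rel q (nat \<lfloor>lam * real (nat \<lfloor>d / q powr \<gamma>\<rfloor>)\<rfloor>))
        (\<lambda>q. T_rel q (nat \<lfloor>d / q powr \<gamma>\<rfloor>)))"
  proof (intro exI[of _ "2 ^ m"] conjI allI impI)
    show "(1::real) < 2 ^ m" using \<open>m \<noteq> 0\<close> by simp
    show "succ_q (\<lambda>q. T_rel q (nat \<lfloor>2 ^ m * real (nat \<lfloor>d / q powr \<gamma>\<rfloor>)\<rfloor>))
        (\<lambda>q. T_rel q (nat \<lfloor>d / q powr \<gamma>\<rfloor>))" if "0 < d" for d
      unfolding nL using succ_q_mesoscopic[OF _ _ m that] g by simp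
  qed
next
  fix \<gamma> d :: real assume g: "0 < \<gamma> \<and> \<gamma> < 1/2" and d: "d > 0"
  have "2 * real L = real (2 ^ 1 * L)" for L by simp
  then have nL: "nat \<lfloor>2 * real L\<rfloor> = 2 ^ 1 * L" for L by (simp only: floor_of_nat nat_int)
  show "succ_q (\<lambda>q. T_rel q (nat \<lfloor>2 * real (nat \<lfloor>d / q powr \<gamma>\<rfloor>)\<rfloor>))
      (\<lambda>q. T_rel q (nat \<lfloor>d / q powr \<gamma>\<rfloor>))"
    \<comment> \<open>One doubling suffices, since \<gamma> < 1 - \<gamma> exactly when \<gamma> <
      1/2.\<close>
    unfolding nL by (rule succ_q_mesoscopic) (use g d in auto)
qed

end
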